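(* Let $X\subset\mathbb{R}^d$ and $Y\subset\mathbb{R}$ be non-empty closed sets. Let $H$ be the RKHS of a bounded continuous kernel $k$ on $X$ with canonical feature map $\Phi:X\to H$, $\Phi(x)=k(\cdot,x)$. Let $L:Y\times\mathbb{R}\to[0,\infty)$ be a convex loss function of some strong type $(a,p)$, such that $L(y,\cdot)$ is twice continuously differentiable for every $y\in Y$. Let $\mathrm{P}$ be a probability distribution on $X\times Y$ with $|\mathrm{P}|_a<\infty$, and let $\lambda>0$. Then the influence function of $T(\mathrm{P}):=f_{\mathrm{P},\lambda}$ exists for all $z:=(x,y)\in X\times Y$, i.e. the limit (in $H$) $$\mathrm{IF}(z;T,\mathrm{P})=\lim_{\varepsilon\downarrow0}\varepsilon^{-1}\big\{f_{(1-\varepsilon)\mathrm{P}+\varepsilon\Delta_z,\lambda}-f_{\mathrm{P},\lambda}\big\}$$ exists, and $$\mathrm{IF}(z;T,\mathrm{P})=S^{-1}\big(\mathbb{E}_{\mathrm{P}}(L'(Y,f_{\mathrm{P},\lambda}(X))\Phi(X))\big)-L'(y,f_{\mathrm{P},\lambda}(x))\,S^{-1}\Phi(x),$$ where $S:H\to H$ is the (invertible) operator $$S=2\lambda\,\mathrm{id}_H+\mathbb{E}_{\mathrm{P}}L''(Y,f_{\mathrm{P},\lambda}(X))\langle\Phi(X),\cdot\rangle\Phi(X).$$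
   Context: A loss function is a measurable $L:Y\times\mathbb{R}\to[0,\infty)$; it is convex if $L(y,\cdot)$ is convex for every $y\in Y$. Let $a:Y\to[0,\infty)$ be measurable and $p\in[0,\infty)$. $L$ is of type $(a,p)$ if there is $c>0$ with $L(y,t)\le c(a(y)+|t|^p+1)$ for all $y\in Y$, $t\in\mathbb{R}$. $L$ is of strong type $(a,p)$ if the first two partial derivatives $L':=\partial_2L$ and $L'':=\partial_{22}L$ with respect to the second argument exist and $L$, $|L'|$ and $|L''|$ all satisfy such an $(a,p)$-type inequality. $|\mathrm{P}|_a:=\int_{X\times Y}a(y)\,d\mathrm{P}(x,y)$. A kernel $k:X\times X\to\mathbb{R}$ is bounded if $\|k\|_\infty:=\sup_{x\in X}\sqrt{k(x,x)}<\infty$. $\Delta_z$ is the Dirac distribution at $z$. Expectations of $H$-valued (or operator-valued) quantities are Bochner integrals; the operator expectation means $g\mapsto\mathbb{E}_{\mathrm{P}}L''(Y,f_{\mathrm{P},\lambda}(X))g(X)\Phi(X)$. For a distribution $\mathrm{Q}$ on $X\times Y$ with $|\mathrm{Q}|_a<\infty$ and $\lambda>0$, $f_{\mathrm{Q},\lambda}\in H$ denotes the minimizer (which exists and is unique) over $f\in H$ of $\mathbb{E}_{\mathrm{Q}}L(Y,f(X))+\lambda\|f\|_H^2$. *)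

theory Defs
  imports "HOL-Probability.Probability"
begin

definition kernel_on :: "'x set \<Rightarrow> ('x \<Rightarrow> 'x \<Rightarrow> real) \<Rightarrow> bool" where
  "kernel_on X k \<longleftrightarrow>
     (\<forall>x\<in>X. \<forall>x'\<in>X. k x x' = k x' x) \<and>
     (\<forall>F c. finite F \<and> F \<subseteq> X \<longrightarrow> 0 \<le> (\<Sum>u\<in>F. \<Sum>v\<in>F. c u * c v * k u v))"

definition bounded_kernel_on :: "'x set \<Rightarrow> ('x \<Rightarrow> 'x \<Rightarrow> real) \<Rightarrow> bool" where
  "bounded_kernel_on X k \<longleftrightarrow> bdd_above ((\<lambda>x. sqrt (k x x)) ` X)"

definition continuous_kernel_on :: "'x::topological_space set \<Rightarrow> ('x \<Rightarrow> 'x \<Rightarrow> real) \<Rightarrow> bool" where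
  "continuous_kernel_on X k \<longleftrightarrow> continuous_on (X \<times> X) (\<lambda>(u, v). k u v)"

text \<open>A Hilbert space type \<open>'h\<close> is regarded as a space of real functions on \<open>X\<close> through the
  injection \<open>fn\<close>: a vector \<open>f\<close> stands for the function \<open>fn f\<close> on \<open>X\<close>. The first three
  conditions say that \<open>f \<mapsto> fn f\<close> is an injective linear map into the functions on \<open>X\<close> (values
  off \<open>X\<close> are irrelevant); the last one says that \<open>k(\<cdot>, x)\<close> belongs to the space and
  reproduces evaluation at \<open>x\<close>. When \<open>X\<close> is a separable metric space and \<open>k\<close> is continuous, such a
  space is separable, so the sort \<open>second_countable_topology\<close>, which the Bochner integral
  \<^const>\<open>lebesgue_integral\<close> demands below, is no restriction.\<close>

definition is_rkhs ::
  "'x set \<Rightarrow> ('x \<Rightarrow> 'x \<Rightarrow> real) \<Rightarrow> ('h::{real_inner, banach} \<Rightarrow> 'x \<Rightarrow> real) \<Rightarrow> bool" where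
  "is_rkhs X k fn \<longleftrightarrow>
     (\<forall>f g. \<forall>x\<in>X. fn (f + g) x = fn f x + fn g x) \<and>
     (\<forall>r f. \<forall>x\<in>X. fn (r *\<^sub>R f) x = r * fn f x) \<and>
     (\<forall>f g. (\<forall>x\<in>X. fn f x = fn g x) \<longrightarrow> f = g) \<and>
     (\<forall>x\<in>X. \<exists>h. (\<forall>u\<in>X. fn h u = k u x) \<and> (\<forall>f. fn f x = inner f h))"

definition canonical_feature_map ::
  "'x set \<Rightarrow> ('x \<Rightarrow> 'x \<Rightarrow> real) \<Rightarrow> ('h \<Rightarrow> 'x \<Rightarrow> real) \<Rightarrow> ('x \<Rightarrow> 'h) \<Rightarrow> bool" where
  "canonical_feature_map X k fn \<Phi> \<longleftrightarrow> (\<forall>x\<in>X. \<forall>u\<in>X. fn (\<Phi> x) u = k u x)"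

definition loss_function :: "real set \<Rightarrow> (real \<Rightarrow> real \<Rightarrow> real) \<Rightarrow> bool" where
  "loss_function Y L \<longleftrightarrow>
     case_prod L \<in> borel_measurable (restrict_space borel Y \<Otimes>\<^sub>M borel) \<and>
     (\<forall>y\<in>Y. \<forall>t. 0 \<le> L y t)"

definition convex_loss :: "real set \<Rightarrow> (real \<Rightarrow> real \<Rightarrow> real) \<Rightarrow> bool" where
  "convex_loss Y L \<longleftrightarrow> (\<forall>y\<in>Y. convex_on UNIV (L y))"

text \<open>\<open>|t|\<^sup>p\<close> with the convention \<open>0\<^sup>0 = 1\<close>; note that \<^term>\<open>0 powr 0 = (0::real)\<close> is true.\<close>

definition abs_pow :: "real \<Rightarrow> real \<Rightarrow> real" where
  "abs_pow t p = (if p = 0 then 1 else \<bar>t\<bar> powr p)"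

definition has_type_bound ::
  "real set \<Rightarrow> (real \<Rightarrow> real) \<Rightarrow> real \<Rightarrow> (real \<Rightarrow> real \<Rightarrow> real) \<Rightarrow> bool" where
  "has_type_bound Y a p G \<longleftrightarrow> (\<exists>c>0. \<forall>y\<in>Y. \<forall>t. G y t \<le> c * (a y + abs_pow t p + 1))"

definition loss_deriv :: "(real \<Rightarrow> real \<Rightarrow> real) \<Rightarrow> real \<Rightarrow> real \<Rightarrow> real" where
  "loss_deriv L y t = deriv (L y) t"

definition loss_deriv2 :: "(real \<Rightarrow> real \<Rightarrow> real) \<Rightarrow> real \<Rightarrow> real \<Rightarrow> real" where
  "loss_deriv2 L y t = deriv (deriv (L y)) t"

definition strong_type ::
  "real set \<Rightarrow> (real \<Rightarrow> real) \<Rightarrow> real \<Rightarrow> (real \<Rightarrow> real \<Rightarrow> real) \<Rightarrow> bool" where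
  "strong_type Y a p L \<longleftrightarrow>
     (\<forall>y\<in>Y. \<forall>t. L y field_differentiable at t) \<and>
     (\<forall>y\<in>Y. \<forall>t. deriv (L y) field_differentiable at t) \<and>
     has_type_bound Y a p L \<and>
     has_type_bound Y a p (\<lambda>y t. \<bar>loss_deriv L y t\<bar>) \<and>
     has_type_bound Y a p (\<lambda>y t. \<bar>loss_deriv2 L y t\<bar>)"

definition prob_distribution_on :: "'z::topological_space set \<Rightarrow> 'z measure \<Rightarrow> bool" where
  "prob_distribution_on Z P \<longleftrightarrow> prob_space P \<and> sets P = sets (restrict_space borel Z)"

definition a_moment :: "(real \<Rightarrow> real) \<Rightarrow> ('x \<times> real) measure \<Rightarrow> ennreal" where
  "a_moment a P = (\<integral>\<^sup>+ z. ennreal (a (snd z)) \<partial>P)"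

text \<open>The risk is taken in \<open>[0, \<infinity>]\<close>, so that no integrability has to be assumed.\<close>

definition reg_risk ::
  "(real \<Rightarrow> real \<Rightarrow> real) \<Rightarrow> ('h::real_normed_vector \<Rightarrow> 'x \<Rightarrow> real) \<Rightarrow> real
     \<Rightarrow> ('x \<times> real) measure \<Rightarrow> 'h \<Rightarrow> ennreal" where
  "reg_risk L fn lam Q f =
     (\<integral>\<^sup>+ z. ennreal (L (snd z) (fn f (fst z))) \<partial>Q) + ennreal (lam * (norm f)\<^sup>2)"

definition svm_solution ::
  "(real \<Rightarrow> real \<Rightarrow> real) \<Rightarrow> ('h::real_normed_vector \<Rightarrow> 'x \<Rightarrow> real) \<Rightarrow> real
     \<Rightarrow> ('x \<times> real) measure \<Rightarrow> 'h" where
  "svm_solution L fn lam Q = (THE f. is_arg_min (reg_risk L fn lam Q) (\<lambda>_. True) f)"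

text \<open>\<open>(1 - \<epsilon>) P + \<epsilon> Q\<close>, meant for \<open>0 \<le> \<epsilon> \<le> 1\<close> and \<open>sets Q = sets P\<close>.\<close>

definition mixture :: "real \<Rightarrow> 'z measure \<Rightarrow> 'z measure \<Rightarrow> 'z measure" where
  "mixture \<epsilon> P Q = measure_of (space P) (sets P)
     (\<lambda>A. ennreal (1 - \<epsilon>) * emeasure P A + ennreal \<epsilon> * emeasure Q A)"

lemma space_mixture [simp]: "space (mixture \<epsilon> P Q) = space P"
  by (simp add: mixture_def)

lemma sets_mixture [simp]: "sets (mixture \<epsilon> P Q) = sets P"
  by (simp add: mixture_def)

lemma emeasure_mixture:
  assumes "sets Q = sets P" and "A \<in> sets P"
  shows "emeasure (mixture \<epsilon> P Q) A = ennreal (1 - \<epsilon>) * emeasure P A + ennreal \<epsilon> * emeasure Q A"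
proof (rule emeasure_measure_of[OF mixture_def])
  show "sets P \<subseteq> Pow (space P)"
    by (rule sets.space_closed)
  show "A \<in> sets (mixture \<epsilon> P Q)"
    using assms by simp
  show "positive (sets (mixture \<epsilon> P Q))
      (\<lambda>A. ennreal (1 - \<epsilon>) * emeasure P A + ennreal \<epsilon> * emeasure Q A)"
    by (simp add: positive_def)
  show "countably_additive (sets (mixture \<epsilon> P Q))
      (\<lambda>A. ennreal (1 - \<epsilon>) * emeasure P A + ennreal \<epsilon> * emeasure Q A)"
  proof (rule countably_additiveI)
    fix B :: "nat \<Rightarrow> 'a set"
    assume B: "range B \<subseteq> sets (mixture \<epsilon> P Q)" "disjoint_family B"
    have P: "(\<Sum>i. emeasure P (B i)) = emeasure P (\<Union>i. B i)"
      using B by (intro suminf_emeasure) auto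
    have Q: "(\<Sum>i. emeasure Q (B i)) = emeasure Q (\<Union>i. B i)"
      using B assms(1) by (intro suminf_emeasure) auto
    show "(\<Sum>i. ennreal (1 - \<epsilon>) * emeasure P (B i) + ennreal \<epsilon> * emeasure Q (B i)) =
        ennreal (1 - \<epsilon>) * emeasure P (\<Union>i. B i) + ennreal \<epsilon> * emeasure Q (\<Union>i. B i)"
      by (simp add: suminf_add[symmetric] P Q)
  qed
qed

definition has_influence_function ::
  "('z measure \<Rightarrow> 'h::real_normed_vector) \<Rightarrow> 'z measure \<Rightarrow> 'z \<Rightarrow> 'h \<Rightarrow> bool" where
  "has_influence_function T P z v \<longleftrightarrow>
     ((\<lambda>\<epsilon>. (1 / \<epsilon>) *\<^sub>R (T (mixture \<epsilon> P (return P z)) - T P)) \<longlongrightarrow> v) (at_right 0)"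

definition hessian_operator ::
  "(real \<Rightarrow> real \<Rightarrow> real) \<Rightarrow> ('h::{real_inner, banach, second_countable_topology} \<Rightarrow> 'x \<Rightarrow> real)
     \<Rightarrow> ('x \<Rightarrow> 'h) \<Rightarrow> real \<Rightarrow> ('x \<times> real) measure \<Rightarrow> 'h \<Rightarrow> 'h" where
  "hessian_operator L fn \<Phi> lam P g =
     (2 * lam) *\<^sub>R g +
     (\<integral>z. (loss_deriv2 L (snd z) (fn (svm_solution L fn lam P) (fst z)) * inner (\<Phi> (fst z)) g)
            *\<^sub>R \<Phi> (fst z) \<partial>P)"

end

theory Submission
  imports Defs
begin

text \<open>No implicit function theorem is needed. By convexity, the gradient \<open>G\<^sub>\<epsilon>\<close> of the regularized
  risk of \<open>(1 - \<epsilon>) P + \<epsilon> \<Delta>\<^sub>z\<close> satisfies \<open>\<langle>G\<^sub>\<epsilon> f - G\<^sub>\<epsilon> g, f - g\<rangle> \<ge> 2 \<lambda> \<parallel>f - g\<parallel>\<^sup>2\<close>, and it is Lipschitz on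
  balls. Hence it has exactly one zero \<open>f\<^sub>\<epsilon>\<close>, which is the minimizer, and
  \<open>\<parallel>f\<^sub>\<epsilon> - f\<^sub>0\<parallel> \<le> \<parallel>G\<^sub>\<epsilon> f\<^sub>0\<parallel> / (2 \<lambda>) = O(\<epsilon>)\<close>. Subtracting \<open>G\<^sub>0 f\<^sub>0 = 0\<close> from \<open>G\<^sub>\<epsilon> f\<^sub>\<epsilon> = 0\<close> and dividing by
  \<open>\<epsilon>\<close> shows that \<open>S ((f\<^sub>\<epsilon> - f\<^sub>0) / \<epsilon>)\<close> is the asserted vector up to an error that vanishes by
  dominated convergence; \<open>S\<close> is invertible because it is coercive.\<close>

section \<open>Strongly monotone maps and coercive operators on a Hilbert space\<close>

text \<open>Strong monotonicity confines any zero to the ball of radius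
  \<open>norm (G 0) / m\<close>, so a Lipschitz bound on balls is enough: Banach's fixed point
  theorem is applied on a ball of twice that radius.\<close>

lemma strongly_monotone_has_zero:
  fixes G :: "'h::{real_inner, banach} \<Rightarrow> 'h"
  assumes "0 < m"
    and mono: "\<And>f g. m * (norm (f - g))\<^sup>2 \<le> inner (G f - G g) (f - g)"
    and lip: "\<And>r. \<exists>K. \<forall>f\<in>cball 0 r. \<forall>g\<in>cball 0 r. norm (G f - G g) \<le> K * norm (f - g)"
  shows "\<exists>f. G f = 0"
proof -
  define r where "r = 2 * norm (G 0) / m"
  obtain K where K: "\<And>f g. f \<in> cball 0 r \<Longrightarrow> g \<in> cball 0 r \<Longrightarrow> norm (G f - G g) \<le> K * norm (f - g)"
    using lip[of r] by blast
  \<comment> \<open>The maximum with \<open>m\<close> makes the Lipschitz constant positive and the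
    contraction factor \<open>q\<close> nonnegative.\<close>
  define \<Lambda> where "\<Lambda> = max K m"
  have \<Lambda>: "0 < \<Lambda>" "m \<le> \<Lambda>" "K \<le> \<Lambda>"
    using \<open>0 < m\<close> by (auto simp: \<Lambda>_def)
  \<comment> \<open>This step size minimizes
    \<open>1 - 2 * \<tau> * m + \<tau>^2 * \<Lambda>^2\<close>, the bound found below for the
    squared contraction factor.\<close>
  define \<tau> where "\<tau> = m / \<Lambda>\<^sup>2"
  \<comment> \<open>A root-free upper bound for the square root of
    \<open>1 - m^2 / \<Lambda>^2\<close>: the square of \<open>q\<close> exceeds that number by the
    square of \<open>m^2 / (2 * \<Lambda>^2)\<close>.\<close>
  define q where "q = 1 - m\<^sup>2 / (2 * \<Lambda>\<^sup>2)"
  have "m\<^sup>2 \<le> \<Lambda>\<^sup>2"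
    using \<Lambda> \<open>0 < m\<close> by (intro power_mono) auto
  then have "m\<^sup>2 \<le> 2 * \<Lambda>\<^sup>2"
    using zero_le_power2[of \<Lambda>] by linarith
  then have q: "0 \<le> q" "q < 1"
    using \<Lambda> \<open>0 < m\<close> by (auto simp: q_def field_simps)
  have \<tau>: "0 < \<tau>"
    using \<Lambda> \<open>0 < m\<close> by (simp add: \<tau>_def)
  let ?F = "\<lambda>f. f - \<tau> *\<^sub>R G f"
  txt \<open>A zero of \<open>G\<close> is a fixed point of \<open>?F\<close>, which for this step size \<open>\<tau>\<close> contracts the ball of
    radius \<open>r\<close> by the factor \<open>q\<close>; the radius is such that \<open>q r + \<tau> \<parallel>G 0\<parallel> = r\<close>.\<close>
  have contr: "norm (?F f - ?F g) \<le> q * norm (f - g)" if "f \<in> cball 0 r" "g \<in> cball 0 r" for f g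
  proof (rule power2_le_imp_le)
    have "norm (G f - G g) \<le> \<Lambda> * norm (f - g)"
      using K[OF that] mult_right_mono[OF \<Lambda>(3), of "norm (f - g)"] by simp
    then have "(norm (G f - G g))\<^sup>2 \<le> (\<Lambda> * norm (f - g))\<^sup>2"
      by (intro power_mono) auto
    then have *: "\<tau>\<^sup>2 * (norm (G f - G g))\<^sup>2 \<le> \<tau>\<^sup>2 * (\<Lambda>\<^sup>2 * (norm (f - g))\<^sup>2)"
      by (intro mult_left_mono) (auto simp: power_mult_distrib)
    have "?F f - ?F g = (f - g) - \<tau> *\<^sub>R (G f - G g)"
      by (simp add: algebra_simps)
    then have "(norm (?F f - ?F g))\<^sup>2
        = (norm (f - g))\<^sup>2 - 2 * \<tau> * inner (G f - G g) (f - g) + \<tau>\<^sup>2 * (norm (G f - G g))\<^sup>2"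
      unfolding power2_norm_eq_inner
      by (simp add: inner_diff_left inner_diff_right inner_commute power2_eq_square algebra_simps)
    also have "\<dots> \<le> (norm (f - g))\<^sup>2 - 2 * \<tau> * (m * (norm (f - g))\<^sup>2) + \<tau>\<^sup>2 * (\<Lambda>\<^sup>2 * (norm (f - g))\<^sup>2)"
      using * mult_left_mono[OF mono[of f g], of "2 * \<tau>"] \<tau> by linarith
    also have "\<dots> = (1 - m\<^sup>2 / \<Lambda>\<^sup>2) * (norm (f - g))\<^sup>2"
      using \<Lambda> by (simp add: \<tau>_def field_simps power2_eq_square)
    also have "\<dots> \<le> q\<^sup>2 * (norm (f - g))\<^sup>2"
      by (intro mult_right_mono) (auto simp: q_def power2_diff)
    finally show "(norm (?F f - ?F g))\<^sup>2 \<le> (q * norm (f - g))\<^sup>2"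
      by (simp add: power_mult_distrib)
    show "0 \<le> q * norm (f - g)"
      using q by simp
  qed
  have r: "0 \<le> r"
    using \<open>0 < m\<close> by (simp add: r_def)
  have "\<exists>!f\<in>cball 0 r. ?F f = f"
  proof (rule Banach_fix)
    show "?F ` cball 0 r \<subseteq> cball 0 r"
    proof safe
      fix f :: 'h assume f: "f \<in> cball 0 r"
      have "norm (?F f) \<le> norm (?F f - ?F 0) + norm (?F 0)"
        using norm_triangle_sub[of "?F f" "?F 0"] by (simp only: add.commute)
      also have "\<dots> \<le> q * r + \<tau> * norm (G 0)"
        using contr[OF f, of 0] r q f mult_left_mono[of "norm f" r q] \<tau> by simp
      also have "\<dots> = r"
        using \<Lambda> \<open>0 < m\<close> by (simp add: q_def r_def \<tau>_def field_simps power2_eq_square)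
      finally show "?F f \<in> cball 0 r"
        by simp
    qed
  qed (use q r contr in \<open>auto simp: dist_norm complete_eq_closed\<close>)
  then show ?thesis
    using \<tau> by auto
qed

text \<open>The Lax-Milgram argument. Coercivity and Cauchy-Schwarz give
  \<open>m * norm g \<le> norm (S g)\<close>, hence injectivity and the bound \<open>1 / m\<close>
  for the inverse; surjectivity comes from a zero of the strongly monotone map sending
  \<open>f\<close> to \<open>S f - h\<close>.\<close>

lemma coercive_bounded_linear_bij:
  fixes S :: "'h::{real_inner, banach} \<Rightarrow> 'h"
  assumes "bounded_linear S" and "0 < m" and coercive: "\<And>g. m * (norm g)\<^sup>2 \<le> inner (S g) g"
  shows "bij S" and "bounded_linear (inv S)"
proof -
  interpret S: bounded_linear S
    by fact
  have lower: "m * norm g \<le> norm (S g)" for g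
  proof (cases "g = 0")
    case False
    have "(m * norm g) * norm g \<le> norm (S g) * norm g"
      using coercive[of g] norm_cauchy_schwarz[of "S g" g] by (simp add: power2_eq_square)
    then show ?thesis
      using False by simp
  qed simp
  have "inj S"
  proof (rule injI)
    fix f g assume "S f = S g"
    then have "m * norm (f - g) \<le> 0"
      using lower[of "f - g"] by (simp add: S.diff)
    then show "f = g"
      using \<open>0 < m\<close> by (simp add: mult_le_0_iff)
  qed
  moreover have "\<exists>f. S f - h = 0" for h
  proof (rule strongly_monotone_has_zero[OF \<open>0 < m\<close>])
    show "m * (norm (f - g))\<^sup>2 \<le> inner (S f - h - (S g - h)) (f - g)" for f g
      using coercive[of "f - g"] by (simp add: S.diff)
    obtain K where K: "\<And>f. norm (S f) \<le> norm f * K"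
      using S.bounded by blast
    have "norm (S f - h - (S g - h)) \<le> K * norm (f - g)" for f g
      using K[of "f - g"] by (simp add: S.diff mult.commute)
    then show "\<exists>K. \<forall>f\<in>cball 0 r. \<forall>g\<in>cball 0 r. norm (S f - h - (S g - h)) \<le> K * norm (f - g)" for r
      by blast
  qed
  then have "surj S"
    unfolding surj_def by (metis eq_iff_diff_eq_0)
  ultimately show "bij S"
    by (rule bijI)
  have inv: "S (inv S h) = h" for h
    using \<open>surj S\<close> by (rule surj_f_inv_f)
  have eqI: "inv S h = f" if "S f = h" for h f
    using that \<open>inj S\<close> by (metis inv_f_f)
  show "bounded_linear (inv S)"
  proof (rule bounded_linear_intro)
    show "inv S (f + g) = inv S f + inv S g" for f g
      by (rule eqI) (simp add: S.add inv)
    show "inv S (c *\<^sub>R f) = c *\<^sub>R inv S f" for c f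
      by (rule eqI) (simp add: S.scaleR inv)
    show "norm (inv S h) \<le> norm h * (1 / m)" for h
      using lower[of "inv S h"] \<open>0 < m\<close> by (simp add: inv field_simps)
  qed
qed

section \<open>Integrals against mixtures of measures\<close>

lemma nn_integral_mixture:
  assumes "sets Q = sets P" and "f \<in> borel_measurable P"
  shows "(\<integral>\<^sup>+ z. f z \<partial>mixture \<epsilon> P Q)
    = ennreal (1 - \<epsilon>) * (\<integral>\<^sup>+ z. f z \<partial>P) + ennreal \<epsilon> * (\<integral>\<^sup>+ z. f z \<partial>Q)"
  using assms(2)
proof (induction rule: borel_measurable_induct)
  have sp: "space Q = space P"
    using assms(1) by (rule sets_eq_imp_space_eq)
  have mQ: "u \<in> borel_measurable Q" if "u \<in> borel_measurable P" for u :: "_ \<Rightarrow> ennreal"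
    using that measurable_cong_sets[OF assms(1) refl] by blast
  have mm: "u \<in> borel_measurable (mixture \<epsilon> P Q)" if "u \<in> borel_measurable P" for u :: "_ \<Rightarrow> ennreal"
    using that measurable_cong_sets[OF sets_mixture refl] by blast
  {
    case (cong f g)
    then show ?case
      using sp nn_integral_cong[of P f g] nn_integral_cong[of Q f g] 
        nn_integral_cong[of "mixture \<epsilon> P Q" f g] by simp
  next
    case (set A)
    then show ?case
      using assms(1) by (simp add: emeasure_mixture)
  next
    case (mult u c)
    then show ?case
      by (simp add: nn_integral_cmult mQ mm distrib_left mult.left_commute)
  next
    case (add u v)
    then show ?case
      by (simp add: nn_integral_add mQ mm distrib_left algebra_simps)
  next
    case (seq U)
    \<comment> \<open>Both integrals increase with \<open>i\<close>, so the supremum of their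
      weighted sum is the weighted sum of their suprema.\<close>
    have "incseq (\<lambda>i. \<integral>\<^sup>+ z. U i z \<partial>N)" for N
      using seq by (auto simp: incseq_def le_fun_def intro!: nn_integral_mono)
    then show ?case
      using seq
      by (simp add: SUP_apply nn_integral_monotone_convergence_SUP mQ mm image_comp
          SUP_mult_left_ennreal ennreal_SUP_add incseq_def mult_left_mono)
  }
qed

section \<open>Abstract setting: regularized risks of smooth convex losses\<close>

text \<open>Kernel and function evaluation are absorbed into \<open>\<phi>\<close>: the prediction
  of \<open>f\<close> at \<open>z\<close> is \<open>inner f (\<phi> z)\<close>. The growth condition
  becomes an integrable envelope on each bounded range of \<open>t\<close>, and measurability is
  stated for compositions, the form in which it enters the integrals.\<close>

locale smooth_convex_risk = prob_space M for M :: "'z measure" +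
  fixes \<phi> :: "'z \<Rightarrow> 'h::{real_inner, banach, second_countable_topology}"
    and l l1 l2 :: "'z \<Rightarrow> real \<Rightarrow> real"
    and \<kappa> lam :: real
  assumes feature_measurable [measurable]: "\<phi> \<in> borel_measurable M"
    and feature_bound: "\<And>z. z \<in> space M \<Longrightarrow> norm (\<phi> z) \<le> \<kappa>"
    and loss_nonneg: "\<And>z t. z \<in> space M \<Longrightarrow> 0 \<le> l z t"
    and loss_deriv: "\<And>z t. z \<in> space M \<Longrightarrow> (l z has_real_derivative l1 z t) (at t)"
    and loss_deriv': "\<And>z t. z \<in> space M \<Longrightarrow> (l1 z has_real_derivative l2 z t) (at t)"
    and loss_deriv2_nonneg: "\<And>z t. z \<in> space M \<Longrightarrow> 0 \<le> l2 z t"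
    and loss_measurable:
      "\<And>u. u \<in> borel_measurable M \<Longrightarrow> (\<lambda>z. l z (u z)) \<in> borel_measurable M"
      "\<And>u. u \<in> borel_measurable M \<Longrightarrow> (\<lambda>z. l1 z (u z)) \<in> borel_measurable M"
      "\<And>u. u \<in> borel_measurable M \<Longrightarrow> (\<lambda>z. l2 z (u z)) \<in> borel_measurable M"
    and loss_bound: "\<And>R. \<exists>b. integrable M b \<and> (\<forall>z\<in>space M. \<forall>t. \<bar>t\<bar> \<le> R \<longrightarrow>
      \<bar>l z t\<bar> \<le> b z \<and> \<bar>l1 z t\<bar> \<le> b z \<and> \<bar>l2 z t\<bar> \<le> b z)"
    and lam_pos: "0 < lam"
begin

lemma feature_bound_nonneg: "0 \<le> \<kappa>"
proof -
  obtain z where "z \<in> space M"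
    using not_empty by blast
  then show ?thesis
    using feature_bound[of z] norm_ge_zero order_trans by blast
qed

lemma abs_inner_feature_le:
  assumes "z \<in> space M"
  shows "\<bar>inner f (\<phi> z)\<bar> \<le> \<kappa> * norm f"
  using Cauchy_Schwarz_ineq2[of f "\<phi> z"] mult_left_mono[OF feature_bound[OF assms], of "norm f"]
  by (simp add: mult.commute)

text \<open>The gradient of \<open>\<lambda>f. l z (inner f (\<phi> z))\<close>, by the chain
  rule.\<close>

definition loss_grad :: "'z \<Rightarrow> 'h \<Rightarrow> 'h" where
  "loss_grad z f = l1 z (inner f (\<phi> z)) *\<^sub>R \<phi> z"

definition risk_grad :: "'h \<Rightarrow> 'h" where
  "risk_grad f = (\<integral>z. loss_grad z f \<partial>M)"

text \<open>The derivative of \<open>reg_grad 0 w\<close> at \<open>f\<close> in direction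
  \<open>g\<close>, for any \<open>w\<close>, since the point mass has weight 0 there.\<close>

definition hessian :: "'h \<Rightarrow> 'h \<Rightarrow> 'h" where
  "hessian f g = (2 * lam) *\<^sub>R g + (\<integral>z. (l2 z (inner f (\<phi> z)) * inner (\<phi> z) g) *\<^sub>R \<phi> z \<partial>M)"

text \<open>The gradient of the regularized risk of the contaminated distribution
  \<open>(1 - \<epsilon>) M + \<epsilon> \<delta>\<close>, with \<open>\<delta>\<close> the point mass at \<open>w\<close>.\<close>

definition reg_grad :: "real \<Rightarrow> 'z \<Rightarrow> 'h \<Rightarrow> 'h" where
  "reg_grad \<epsilon> w f = (2 * lam) *\<^sub>R f + (1 - \<epsilon>) *\<^sub>R risk_grad f + \<epsilon> *\<^sub>R loss_grad w f"

lemma loss_grad_measurable [measurable]: "(\<lambda>z. loss_grad z f) \<in> borel_measurable M"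
  unfolding loss_grad_def using loss_measurable(2)[of "\<lambda>z. inner f (\<phi> z)"] by measurable

text \<open>For \<open>f\<close> in the ball of radius \<open>R\<close> the predictions stay within
  \<open>\<kappa> * R\<close>, so one envelope serves the whole ball. Passing to the absolute value
  makes it nonnegative even if no \<open>t\<close> is in range.\<close>

lemma loss_bound_feature:
  obtains b where "integrable M b"
    and "\<And>z. z \<in> space M \<Longrightarrow> 0 \<le> b z"
    and "\<And>z t. z \<in> space M \<Longrightarrow> \<bar>t\<bar> \<le> \<kappa> * R \<Longrightarrow> \<bar>l z t\<bar> \<le> b z"
    and "\<And>z t. z \<in> space M \<Longrightarrow> \<bar>t\<bar> \<le> \<kappa> * R \<Longrightarrow> \<bar>l1 z t\<bar> \<le> b z"
    and "\<And>z t. z \<in> space M \<Longrightarrow> \<bar>t\<bar> \<le> \<kappa> * R \<Longrightarrow> \<bar>l2 z t\<bar> \<le> b z"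
proof -
  obtain b where b: "integrable M b" "\<forall>z\<in>space M. \<forall>t. \<bar>t\<bar> \<le> \<kappa> * R \<longrightarrow>
      \<bar>l z t\<bar> \<le> b z \<and> \<bar>l1 z t\<bar> \<le> b z \<and> \<bar>l2 z t\<bar> \<le> b z"
    using loss_bound[of "\<kappa> * R"] by blast
  show ?thesis
    by (rule that[of "\<lambda>z. \<bar>b z\<bar>"]) (use b in \<open>auto intro: order_trans[OF _ abs_ge_self]\<close>)
qed

lemma integrable_loss: "integrable M (\<lambda>z. l z (inner f (\<phi> z)))"
proof -
  obtain b where b: "integrable M b"
    "\<And>z t. z \<in> space M \<Longrightarrow> \<bar>t\<bar> \<le> \<kappa> * norm f \<Longrightarrow> \<bar>l z t\<bar> \<le> b z"
    by (rule loss_bound_feature[where R = "norm f"]) blast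
  show ?thesis
    using b abs_inner_feature_le
    by (intro Bochner_Integration.integrable_bound[OF b(1)] AE_I2)
      (auto intro!: loss_measurable intro: order_trans[OF _ abs_ge_self])
qed

lemma integrable_loss_grad: "integrable M (\<lambda>z. loss_grad z f)"
proof -
  obtain b where b: "integrable M b" "\<And>z. z \<in> space M \<Longrightarrow> 0 \<le> b z"
    "\<And>z t. z \<in> space M \<Longrightarrow> \<bar>t\<bar> \<le> \<kappa> * norm f \<Longrightarrow> \<bar>l1 z t\<bar> \<le> b z"
    by (rule loss_bound_feature[where R = "norm f"]) blast
  show ?thesis
  proof (rule Bochner_Integration.integrable_bound)
    show "integrable M (\<lambda>z. b z * \<kappa>)"
      using b(1) by simp
    show "AE z in M. norm (loss_grad z f) \<le> norm (b z * \<kappa>)"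
    proof (rule AE_I2)
      fix z assume z: "z \<in> space M"
      have "norm (loss_grad z f) \<le> b z * \<kappa>"
        unfolding loss_grad_def norm_scaleR
        using b(2,3)[OF z] abs_inner_feature_le[OF z] feature_bound[OF z] by (intro mult_mono) auto
      then show "norm (loss_grad z f) \<le> norm (b z * \<kappa>)"
        unfolding real_norm_def by (rule order_trans[OF _ abs_ge_self])
    qed
  qed measurable
qed

lemma integrable_loss_hessian:
  "integrable M (\<lambda>z. (l2 z (inner f (\<phi> z)) * inner (\<phi> z) g) *\<^sub>R \<phi> z)"
proof -
  obtain b where b: "integrable M b" "\<And>z. z \<in> space M \<Longrightarrow> 0 \<le> b z"
    "\<And>z t. z \<in> space M \<Longrightarrow> \<bar>t\<bar> \<le> \<kappa> * norm f \<Longrightarrow> \<bar>l2 z t\<bar> \<le> b z"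
    by (rule loss_bound_feature[where R = "norm f"]) blast
  have [measurable]: "(\<lambda>z. l2 z (inner f (\<phi> z))) \<in> borel_measurable M"
    by (rule loss_measurable) measurable
  show ?thesis
  proof (rule Bochner_Integration.integrable_bound)
    show "integrable M (\<lambda>z. b z * (\<kappa> * norm g) * \<kappa>)"
      using b(1) by simp
    show "AE z in M. norm ((l2 z (inner f (\<phi> z)) * inner (\<phi> z) g) *\<^sub>R \<phi> z)
        \<le> norm (b z * (\<kappa> * norm g) * \<kappa>)"
    proof (rule AE_I2)
      fix z assume z: "z \<in> space M"
      have "\<bar>l2 z (inner f (\<phi> z))\<bar> * \<bar>inner (\<phi> z) g\<bar> * norm (\<phi> z) \<le> b z * (\<kappa> * norm g) * \<kappa>"
        using b(2,3)[OF z] abs_inner_feature_le[OF z] feature_bound[OF z] feature_bound_nonneg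
        by (intro mult_mono) (simp_all add: inner_commute[of _ g])
      then show "norm ((l2 z (inner f (\<phi> z)) * inner (\<phi> z) g) *\<^sub>R \<phi> z)
          \<le> norm (b z * (\<kappa> * norm g) * \<kappa>)"
        unfolding real_norm_def norm_scaleR abs_mult[of "l2 _ _"] by (rule order_trans[OF _ abs_ge_self])
    qed
  qed measurable
qed

section \<open>Monotonicity of the gradients\<close>

lemma loss_deriv_mono:
  assumes "z \<in> space M" and "s \<le> t"
  shows "l1 z s \<le> l1 z t"
  using loss_deriv'[OF assms(1)] loss_deriv2_nonneg[OF assms(1)]
  by (intro DERIV_nonneg_imp_nondecreasing[OF assms(2)]) blast

lemma loss_above_tangent:
  assumes "z \<in> space M"
  shows "l z s + l1 z s * (t - s) \<le> l z t"
proof -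
  have "convex_on UNIV (l z)"
    by (rule f''_ge0_imp_convex) (use assms loss_deriv loss_deriv' loss_deriv2_nonneg in auto)
  then show ?thesis
    using convex_on_imp_above_tangent[of UNIV "l z" s t "l1 z s"] loss_deriv[OF assms, of s] by simp
qed

lemma inner_risk_grad: "inner (risk_grad f) g = (\<integral>z. inner (loss_grad z f) g \<partial>M)"
  by (simp add: risk_grad_def integrable_loss_grad)

text \<open>The inner product is the increment of \<open>l1 z\<close> times the increment of its
  argument, and \<open>l1 z\<close> is nondecreasing.\<close>

lemma loss_grad_mono:
  assumes "z \<in> space M"
  shows "0 \<le> inner (loss_grad z f - loss_grad z g) (f - g)"
proof -
  have "inner (loss_grad z f - loss_grad z g) (f - g)
    = (l1 z (inner f (\<phi> z)) - l1 z (inner g (\<phi> z))) * (inner f (\<phi> z) - inner g (\<phi> z))"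
    by (simp add: loss_grad_def inner_diff_left inner_diff_right inner_commute algebra_simps)
  also have "\<dots> \<ge> 0"
    using loss_deriv_mono[OF assms, of "inner f (\<phi> z)" "inner g (\<phi> z)"]
      loss_deriv_mono[OF assms, of "inner g (\<phi> z)" "inner f (\<phi> z)"]
    by (cases "inner f (\<phi> z) \<le> inner g (\<phi> z)") (auto simp: mult_nonpos_nonpos)
  finally show ?thesis .
qed

lemma risk_grad_mono: "0 \<le> inner (risk_grad f - risk_grad g) (f - g)"
proof -
  have "inner (risk_grad f - risk_grad g) (f - g)
      = (\<integral>z. inner (loss_grad z f - loss_grad z g) (f - g) \<partial>M)"
    by (simp add: inner_diff_left inner_risk_grad Bochner_Integration.integral_diff integrable_loss_grad)
  also have "\<dots> \<ge> 0"
    by (intro integral_nonneg_AE AE_I2 loss_grad_mono)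
  finally show ?thesis .
qed

text \<open>The constant comes from the regularizer alone and is thus uniform in \<epsilon>; the
  loss terms are monotone and carry nonnegative weights.\<close>

lemma reg_grad_strongly_monotone:
  assumes "w \<in> space M" and "0 \<le> \<epsilon>" and "\<epsilon> \<le> 1"
  shows "2 * lam * (norm (f - g))\<^sup>2 \<le> inner (reg_grad \<epsilon> w f - reg_grad \<epsilon> w g) (f - g)"
proof -
  have "inner (reg_grad \<epsilon> w f - reg_grad \<epsilon> w g) (f - g) = 2 * lam * (norm (f - g))\<^sup>2
      + (1 - \<epsilon>) * inner (risk_grad f - risk_grad g) (f - g)
      + \<epsilon> * inner (loss_grad w f - loss_grad w g) (f - g)"
    unfolding reg_grad_def power2_norm_eq_inner
    by (simp add: inner_diff_left inner_add_left algebra_simps)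
  then show ?thesis
    using assms risk_grad_mono[of f g] loss_grad_mono[OF assms(1), of f g] by simp
qed

section \<open>Lipschitz bounds on balls and existence of a zero of the gradient\<close>

text \<open>The mean value bound for \<open>l1 z\<close> on the range of predictions. One factor
  \<open>\<kappa>\<close> comes from the argument of \<open>l1 z\<close>, the other from the vector
  \<open>\<phi> z\<close> that it multiplies.\<close>

lemma loss_grad_lipschitz:
  assumes "z \<in> space M" and "f \<in> cball 0 r" and "g \<in> cball 0 r"
    and B: "\<And>t. \<bar>t\<bar> \<le> \<kappa> * r \<Longrightarrow> \<bar>l2 z t\<bar> \<le> B"
  shows "norm (loss_grad z f - loss_grad z g) \<le> B * \<kappa>\<^sup>2 * norm (f - g)"
proof -
  let ?I = "{- (\<kappa> * r)..\<kappa> * r}"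
  have in_I: "inner h (\<phi> z) \<in> ?I" if "h \<in> cball 0 r" for h
    using abs_inner_feature_le[OF assms(1), of h] that
      mult_left_mono[of "norm h" r \<kappa>] feature_bound_nonneg by (auto simp: abs_le_iff)
  have "norm (l1 z (inner f (\<phi> z)) - l1 z (inner g (\<phi> z)))
      \<le> B * norm (inner f (\<phi> z) - inner g (\<phi> z))"
  proof (rule field_differentiable_bound)
    show "(l1 z has_field_derivative l2 z t) (at t within ?I)" for t
      using loss_deriv'[OF assms(1)] by (rule has_field_derivative_at_within)
    show "norm (l2 z t) \<le> B" if "t \<in> ?I" for t
      using that B[of t] by auto
  qed (use in_I assms in auto)
  also have "\<dots> \<le> B * (\<kappa> * norm (f - g))"
  proof (rule mult_left_mono)
    show "norm (inner f (\<phi> z) - inner g (\<phi> z)) \<le> \<kappa> * norm (f - g)"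
      using abs_inner_feature_le[OF assms(1), of "f - g"] by (simp add: inner_diff_left)
    \<comment> \<open>The sign of \<open>B\<close> is read off from its bound at this one admissible
      point.\<close>
    have "\<bar>inner f (\<phi> z)\<bar> \<le> \<kappa> * r"
      using in_I[OF assms(2)] by auto
    then show "0 \<le> B"
      using B order_trans[OF abs_ge_zero] by blast
  qed
  finally have *: "\<bar>l1 z (inner f (\<phi> z)) - l1 z (inner g (\<phi> z))\<bar> \<le> B * (\<kappa> * norm (f - g))"
    by simp
  have "norm (loss_grad z f - loss_grad z g)
      = \<bar>l1 z (inner f (\<phi> z)) - l1 z (inner g (\<phi> z))\<bar> * norm (\<phi> z)"
    by (simp add: loss_grad_def flip: scaleR_left_diff_distrib)
  also have "\<dots> \<le> B * (\<kappa> * norm (f - g)) * \<kappa>"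
    using * feature_bound[OF assms(1)] by (intro mult_mono) (auto intro: order_trans[OF abs_ge_zero])
  finally show ?thesis
    by (simp add: power2_eq_square algebra_simps)
qed

lemma loss_grad_locally_lipschitz:
  assumes "w \<in> space M"
  shows "\<exists>K. \<forall>f\<in>cball 0 r. \<forall>g\<in>cball 0 r. norm (loss_grad w f - loss_grad w g) \<le> K * norm (f - g)"
proof -
  obtain b where "\<And>z t. z \<in> space M \<Longrightarrow> \<bar>t\<bar> \<le> \<kappa> * r \<Longrightarrow> \<bar>l2 z t\<bar> \<le> b z"
    by (rule loss_bound_feature[where R = r]) blast
  then show ?thesis
    using loss_grad_lipschitz[OF assms] assms by blast
qed

lemma risk_grad_locally_lipschitz:
  "\<exists>K. \<forall>f\<in>cball 0 r. \<forall>g\<in>cball 0 r. norm (risk_grad f - risk_grad g) \<le> K * norm (f - g)"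
proof -
  obtain b where b: "integrable M b"
    "\<And>z t. z \<in> space M \<Longrightarrow> \<bar>t\<bar> \<le> \<kappa> * r \<Longrightarrow> \<bar>l2 z t\<bar> \<le> b z"
    by (rule loss_bound_feature[where R = r]) blast
  have "norm (risk_grad f - risk_grad g) \<le> (\<integral>z. b z \<partial>M) * \<kappa>\<^sup>2 * norm (f - g)"
    if "f \<in> cball 0 r" "g \<in> cball 0 r" for f g
  proof -
    have "risk_grad f - risk_grad g = (\<integral>z. loss_grad z f - loss_grad z g \<partial>M)"
      by (simp add: risk_grad_def integrable_loss_grad)
    also have "norm \<dots> \<le> (\<integral>z. norm (loss_grad z f - loss_grad z g) \<partial>M)"
      by (rule integral_norm_bound)
    also have "\<dots> \<le> (\<integral>z. b z * \<kappa>\<^sup>2 * norm (f - g) \<partial>M)"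
      using b integrable_loss_grad loss_grad_lipschitz[OF _ that] by (intro integral_mono) auto
    finally show ?thesis
      by simp
  qed
  then show ?thesis
    by blast
qed

lemma reg_grad_has_zero:
  assumes "w \<in> space M" and "0 \<le> \<epsilon>" and "\<epsilon> \<le> 1"
  shows "\<exists>f. reg_grad \<epsilon> w f = 0"
proof (rule strongly_monotone_has_zero)
  show "0 < 2 * lam"
    using lam_pos by simp
  show "2 * lam * (norm (f - g))\<^sup>2 \<le> inner (reg_grad \<epsilon> w f - reg_grad \<epsilon> w g) (f - g)" for f g
    by (rule reg_grad_strongly_monotone[OF assms])
  show "\<exists>K. \<forall>f\<in>cball 0 r. \<forall>g\<in>cball 0 r. norm (reg_grad \<epsilon> w f - reg_grad \<epsilon> w g) \<le> K * norm (f - g)"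
    for r
  proof -
    obtain K1 where K1: "\<And>f g. f \<in> cball 0 r \<Longrightarrow> g \<in> cball 0 r \<Longrightarrow>
        norm (risk_grad f - risk_grad g) \<le> K1 * norm (f - g)"
      using risk_grad_locally_lipschitz[of r] by blast
    obtain K2 where K2: "\<And>f g. f \<in> cball 0 r \<Longrightarrow> g \<in> cball 0 r \<Longrightarrow>
        norm (loss_grad w f - loss_grad w g) \<le> K2 * norm (f - g)"
      using loss_grad_locally_lipschitz[OF assms(1), of r] by blast
    have "norm (reg_grad \<epsilon> w f - reg_grad \<epsilon> w g) \<le> (2 * lam + (1 - \<epsilon>) * K1 + \<epsilon> * K2) * norm (f - g)"
      if fg: "f \<in> cball 0 r" "g \<in> cball 0 r" for f g
    proof -
      have "reg_grad \<epsilon> w f - reg_grad \<epsilon> w g = (2 * lam) *\<^sub>R (f - g)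
          + (1 - \<epsilon>) *\<^sub>R (risk_grad f - risk_grad g) + \<epsilon> *\<^sub>R (loss_grad w f - loss_grad w g)"
        by (simp add: reg_grad_def algebra_simps)
      also have "norm \<dots> \<le> norm ((2 * lam) *\<^sub>R (f - g))
          + norm ((1 - \<epsilon>) *\<^sub>R (risk_grad f - risk_grad g)) + norm (\<epsilon> *\<^sub>R (loss_grad w f - loss_grad w g))"
        by (intro norm_triangle_le add_right_mono norm_triangle_ineq)
      also have "\<dots> = 2 * lam * norm (f - g) + (1 - \<epsilon>) * norm (risk_grad f - risk_grad g)
          + \<epsilon> * norm (loss_grad w f - loss_grad w g)"
        using assms lam_pos by simp
      also have "\<dots> \<le> 2 * lam * norm (f - g) + (1 - \<epsilon>) * (K1 * norm (f - g)) + \<epsilon> * (K2 * norm (f - g))"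
        using assms lam_pos K1[OF fg] K2[OF fg] by (intro add_mono mult_left_mono) auto
      finally show ?thesis
        by (simp add: algebra_simps)
    qed
    then show ?thesis
      by blast
  qed
qed

section \<open>The zero of the gradient as the unique minimizer\<close>

text \<open>Kept real-valued and free of the mixture measure; \<open>nn_integral_reg_obj\<close>
  identifies it with the risk in [0, \<infinity>].\<close>

definition reg_obj :: "real \<Rightarrow> 'z \<Rightarrow> 'h \<Rightarrow> real" where
  "reg_obj \<epsilon> w f = (1 - \<epsilon>) * (\<integral>z. l z (inner f (\<phi> z)) \<partial>M) + \<epsilon> * l w (inner f (\<phi> w))
    + lam * (norm f)\<^sup>2"

lemma reg_obj_nonneg:
  assumes "w \<in> space M" and "0 \<le> \<epsilon>" and "\<epsilon> \<le> 1"
  shows "0 \<le> reg_obj \<epsilon> w f"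
  unfolding reg_obj_def using assms lam_pos loss_nonneg
  by (intro add_nonneg_nonneg mult_nonneg_nonneg integral_nonneg_AE AE_I2) auto

lemma loss_above_grad:
  assumes "z \<in> space M"
  shows "l z (inner f (\<phi> z)) + inner (loss_grad z f) (g - f) \<le> l z (inner g (\<phi> z))"
  using loss_above_tangent[OF assms, of "inner f (\<phi> z)" "inner g (\<phi> z)"]
  by (simp add: loss_grad_def inner_diff_right inner_commute)

text \<open>The tangent inequality for the loss is integrated over \<open>M\<close> and taken at
  \<open>w\<close>; expanding the squared norm around \<open>f\<close> is exact and leaves the
  quadratic term.\<close>

lemma reg_obj_strongly_convex:
  assumes "w \<in> space M" and "0 \<le> \<epsilon>" and "\<epsilon> \<le> 1"
  shows "reg_obj \<epsilon> w f + inner (reg_grad \<epsilon> w f) (g - f) + lam * (norm (g - f))\<^sup>2 \<le> reg_obj \<epsilon> w g"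
proof -
  have "(\<integral>z. l z (inner f (\<phi> z)) \<partial>M) + inner (risk_grad f) (g - f)
      = (\<integral>z. l z (inner f (\<phi> z)) + inner (loss_grad z f) (g - f) \<partial>M)"
    unfolding inner_risk_grad
    by (intro Bochner_Integration.integral_add[symmetric] integrable_loss integrable_inner_left
        integrable_loss_grad)
  also have "\<dots> \<le> (\<integral>z. l z (inner g (\<phi> z)) \<partial>M)"
    by (intro integral_mono loss_above_grad Bochner_Integration.integrable_add integrable_loss
        integrable_inner_left integrable_loss_grad)
  finally have "(1 - \<epsilon>) * ((\<integral>z. l z (inner f (\<phi> z)) \<partial>M) + inner (risk_grad f) (g - f))
      \<le> (1 - \<epsilon>) * (\<integral>z. l z (inner g (\<phi> z)) \<partial>M)"
    using assms by (intro mult_left_mono) auto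
  moreover have "\<epsilon> * (l w (inner f (\<phi> w)) + inner (loss_grad w f) (g - f)) \<le> \<epsilon> * l w (inner g (\<phi> w))"
    using assms by (intro mult_left_mono loss_above_grad) auto
  moreover have "lam * (norm g)\<^sup>2 = lam * (norm f)\<^sup>2 + 2 * lam * inner f (g - f) + lam * (norm (g - f))\<^sup>2"
    unfolding power2_norm_eq_inner
    by (simp add: inner_diff_left inner_diff_right inner_commute algebra_simps)
  ultimately show ?thesis
    by (simp add: reg_obj_def reg_grad_def inner_add_left algebra_simps)
qed

text \<open>At a zero \<open>f\<close> of the gradient the linear term vanishes, so every
  \<open>h\<close> is worse than \<open>f\<close> by at least \<open>lam * (norm (h - f))^2\<close>;
  this gives minimality and uniqueness together.\<close>

lemma reg_obj_argmin_iff: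
  assumes "w \<in> space M" and "0 \<le> \<epsilon>" and "\<epsilon> \<le> 1" and zero: "reg_grad \<epsilon> w f = 0"
  shows "(\<forall>h. reg_obj \<epsilon> w g \<le> reg_obj \<epsilon> w h) \<longleftrightarrow> g = f"
proof -
  have *: "reg_obj \<epsilon> w f + lam * (norm (h - f))\<^sup>2 \<le> reg_obj \<epsilon> w h" for h
    using reg_obj_strongly_convex[OF assms(1-3), of f h] zero by simp
  show ?thesis
  proof
    assume "\<forall>h. reg_obj \<epsilon> w g \<le> reg_obj \<epsilon> w h"
    then have "lam * (norm (g - f))\<^sup>2 \<le> 0"
      using *[of g] by (meson add_le_same_cancel1 order_trans)
    then show "g = f"
      using lam_pos by (simp add: mult_le_0_iff)
  next
    assume "g = f"
    then show "\<forall>h. reg_obj \<epsilon> w g \<le> reg_obj \<epsilon> w h"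
      using * lam_pos by (meson add_increasing2 le_add_same_cancel1 mult_nonneg_nonneg order_less_imp_le order_trans zero_le_power2)
  qed
qed

section \<open>Invertibility of the Hessian operator\<close>

lemma hessian_bounded_linear: "bounded_linear (hessian f)"
proof -
  obtain b where b: "integrable M b" "\<And>z. z \<in> space M \<Longrightarrow> 0 \<le> b z"
    "\<And>z t. z \<in> space M \<Longrightarrow> \<bar>t\<bar> \<le> \<kappa> * norm f \<Longrightarrow> \<bar>l2 z t\<bar> \<le> b z"
    by (rule loss_bound_feature[where R = "norm f"]) blast
  let ?h = "\<lambda>g z. (l2 z (inner f (\<phi> z)) * inner (\<phi> z) g) *\<^sub>R \<phi> z"
  show ?thesis
  proof (rule bounded_linear_intro)
    show "hessian f (g + h) = hessian f g + hessian f h" for g h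
    proof -
      have "(\<integral>z. ?h (g + h) z \<partial>M) = (\<integral>z. ?h g z + ?h h z \<partial>M)"
        by (simp add: inner_add_right algebra_simps)
      also have "\<dots> = (\<integral>z. ?h g z \<partial>M) + (\<integral>z. ?h h z \<partial>M)"
        by (intro Bochner_Integration.integral_add integrable_loss_hessian)
      finally show ?thesis
        by (simp add: hessian_def scaleR_add_right)
    qed
    show "hessian f (c *\<^sub>R g) = c *\<^sub>R hessian f g" for c g
    proof -
      have "(\<integral>z. ?h (c *\<^sub>R g) z \<partial>M) = (\<integral>z. c *\<^sub>R ?h g z \<partial>M)"
        by (simp add: algebra_simps)
      also have "\<dots> = c *\<^sub>R (\<integral>z. ?h g z \<partial>M)"
        by (rule integral_scaleR_right)
      finally show ?thesis
        by (simp add: hessian_def algebra_simps)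
    qed
    show "norm (hessian f g) \<le> norm g * (2 * lam + (\<integral>z. b z \<partial>M) * \<kappa>\<^sup>2)" for g
    proof -
      have "norm (\<integral>z. ?h g z \<partial>M) \<le> (\<integral>z. norm (?h g z) \<partial>M)"
        by (rule integral_norm_bound)
      also have "\<dots> \<le> (\<integral>z. b z * (\<kappa>\<^sup>2 * norm g) \<partial>M)"
      proof (rule integral_mono)
        fix z
        assume z: "z \<in> space M"
        have "\<bar>l2 z (inner f (\<phi> z))\<bar> * \<bar>inner (\<phi> z) g\<bar> * norm (\<phi> z) \<le> b z * (\<kappa> * norm g) * \<kappa>"
          using b(2,3)[OF z] abs_inner_feature_le[OF z] feature_bound[OF z] feature_bound_nonneg
          by (intro mult_mono) (simp_all add: inner_commute[of _ g])
        then show "norm (?h g z) \<le> b z * (\<kappa>\<^sup>2 * norm g)"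
          by (simp add: abs_mult power2_eq_square algebra_simps)
      next
        show "integrable M (\<lambda>z. norm (?h g z))"
          by (intro integrable_norm integrable_loss_hessian)
      qed (use b in simp)
      finally have "norm (\<integral>z. ?h g z \<partial>M) \<le> (\<integral>z. b z \<partial>M) * (\<kappa>\<^sup>2 * norm g)"
        by simp
      moreover have "norm (hessian f g) \<le> norm ((2 * lam) *\<^sub>R g) + norm (\<integral>z. ?h g z \<partial>M)"
        unfolding hessian_def by (rule norm_triangle_ineq)
      ultimately show ?thesis
        using lam_pos by (simp add: algebra_simps)
    qed
  qed
qed

text \<open>The integral term contributes the integral of \<open>l2\<close>, which is nonnegative by
  convexity, times a square.\<close>

lemma hessian_coercive: "2 * lam * (norm g)\<^sup>2 \<le> inner (hessian f g) g"
proof -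
  have "inner (\<integral>z. (l2 z (inner f (\<phi> z)) * inner (\<phi> z) g) *\<^sub>R \<phi> z \<partial>M) g
      = (\<integral>z. l2 z (inner f (\<phi> z)) * (inner (\<phi> z) g)\<^sup>2 \<partial>M)"
    using integrable_loss_hessian[of f g]
    by (simp add: power2_eq_square mult.assoc flip: integral_inner_left)
  also have "\<dots> \<ge> 0"
    by (intro integral_nonneg_AE AE_I2 mult_nonneg_nonneg loss_deriv2_nonneg) auto
  finally show ?thesis
    by (simp add: hessian_def inner_add_left power2_norm_eq_inner)
qed

lemma hessian_bij: "bij (hessian f)"
  and hessian_inv_bounded_linear: "bounded_linear (inv (hessian f))"
proof -
  have "0 < 2 * lam"
    using lam_pos by simp
  then show "bij (hessian f)" "bounded_linear (inv (hessian f))"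
    using coercive_bounded_linear_bij[OF hessian_bounded_linear _ hessian_coercive] by blast+
qed

section \<open>Dependence of the minimizer on the contamination\<close>

text \<open>The gradient is affine in \<epsilon>, so its residual at the uncontaminated zero
  \<open>f\<close> is proportional to \<epsilon>; strong monotonicity turns the residual into a
  distance.\<close>

lemma reg_grad_zero_dist:
  assumes "w \<in> space M" and "0 \<le> \<epsilon>" and "\<epsilon> \<le> 1"
    and "reg_grad 0 w f = 0" and "reg_grad \<epsilon> w g = 0"
  shows "norm (g - f) \<le> norm (loss_grad w f - risk_grad f) / (2 * lam) * \<epsilon>"
proof (cases "g = f")
  case True
  then show ?thesis
    using assms lam_pos by simp
next
  case False
  have eq: "reg_grad \<epsilon> w f = \<epsilon> *\<^sub>R (loss_grad w f - risk_grad f)"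
    using assms(4) by (simp add: reg_grad_def algebra_simps)
  have "2 * lam * (norm (g - f))\<^sup>2 \<le> inner (reg_grad \<epsilon> w g - reg_grad \<epsilon> w f) (g - f)"
    by (rule reg_grad_strongly_monotone[OF assms(1-3)])
  also have "\<dots> \<le> norm (reg_grad \<epsilon> w g - reg_grad \<epsilon> w f) * norm (g - f)"
    by (rule norm_cauchy_schwarz)
  also have "norm (reg_grad \<epsilon> w g - reg_grad \<epsilon> w f) = \<epsilon> * norm (loss_grad w f - risk_grad f)"
    using assms by (simp add: eq)
  finally have "(2 * lam * norm (g - f)) * norm (g - f)
      \<le> (\<epsilon> * norm (loss_grad w f - risk_grad f)) * norm (g - f)"
    by (simp add: power2_eq_square algebra_simps)
  then have "2 * lam * norm (g - f) \<le> \<epsilon> * norm (loss_grad w f - risk_grad f)"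
    using False by (subst (asm) mult_le_cancel_right) auto
  then show ?thesis
    using lam_pos by (simp add: field_simps)
qed

text \<open>Differentiability of \<open>risk_grad\<close> along directions
  \<open>(F n - f) / \<epsilon> n\<close> that are known to be bounded but not yet to converge. The
  error is therefore measured against the derivative in the \<open>n\<close>-th direction
  itself.\<close>

lemma risk_grad_diff_quotient:
  assumes \<epsilon>: "\<And>n. 0 < \<epsilon> n" "\<epsilon> \<longlonglongrightarrow> 0"
    and C: "\<And>n. norm (F n - f) \<le> C * \<epsilon> n"
  shows "(\<lambda>n. (1 / \<epsilon> n) *\<^sub>R (risk_grad (F n) - risk_grad f)
    - (\<integral>z. (l2 z (inner f (\<phi> z)) * inner (\<phi> z) ((1 / \<epsilon> n) *\<^sub>R (F n - f))) *\<^sub>R \<phi> z \<partial>M)) \<longlonglongrightarrow> 0"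
proof -
  have "0 \<le> C * \<epsilon> 0"
    using C[of 0] norm_ge_zero order_trans by blast
  then have C0: "0 \<le> C"
    using \<epsilon>(1)[of 0] by (simp add: zero_le_mult_iff)
  define q where "q n = (1 / \<epsilon> n) *\<^sub>R (F n - f)" for n
  have q: "norm (q n) \<le> C" for n
    using C[of n] \<epsilon>(1)[of n] by (simp add: q_def pos_divide_le_eq)
  have Fq: "F n = f + \<epsilon> n *\<^sub>R q n" for n
    using \<epsilon>(1)[of n] by (simp add: q_def)
  \<comment> \<open>A bound on the step sizes places \<open>f\<close> and all \<open>F n\<close> in
    a common ball, and thus under one envelope.\<close>
  obtain e where e: "\<And>n. \<epsilon> n \<le> e"
  proof -
    have "bounded (range \<epsilon>)"
      using \<epsilon>(2) convergent_imp_bounded by blast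
    then obtain e where "\<And>n. \<bar>\<epsilon> n\<bar> \<le> e"
      by (auto simp: bounded_iff)
    then show ?thesis
      using that abs_le_D1 by blast
  qed
  define r where "r = norm f + C * e"
  have in_r: "F n \<in> cball 0 r" "f \<in> cball 0 r" for n
  proof -
    have "norm (F n) \<le> norm f + norm (F n - f)"
      by (rule norm_triangle_sub)
    also have "norm (F n - f) \<le> C * e"
      using C[of n] mult_left_mono[OF e C0, of n] by linarith
    finally show "F n \<in> cball 0 r"
      by (simp add: r_def)
    have "0 \<le> C * e"
      using C0 e[of 0] \<epsilon>(1)[of 0] by simp
    then show "f \<in> cball 0 r"
      by (simp add: r_def)
  qed
  obtain b where b: "integrable M b" "\<And>z. z \<in> space M \<Longrightarrow> 0 \<le> b z"
    "\<And>z t. z \<in> space M \<Longrightarrow> \<bar>t\<bar> \<le> \<kappa> * r \<Longrightarrow> \<bar>l2 z t\<bar> \<le> b z"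
    by (rule loss_bound_feature[where R = r]) blast
  let ?h = "\<lambda>n z. (l2 z (inner f (\<phi> z)) * inner (\<phi> z) (q n)) *\<^sub>R \<phi> z"
  \<comment> \<open>The integrand of the error; dominated convergence will send its integral to
    0.\<close>
  define s where "s n z = (1 / \<epsilon> n) *\<^sub>R (loss_grad z (F n) - loss_grad z f) - ?h n z" for n z
  have s_int: "integrable M (s n)" for n
    unfolding s_def
    by (intro Bochner_Integration.integrable_diff integrable_scaleR_right integrable_loss_grad
        integrable_loss_hessian)
  have s_eq: "(\<integral>z. s n z \<partial>M) = (1 / \<epsilon> n) *\<^sub>R (risk_grad (F n) - risk_grad f) - (\<integral>z. ?h n z \<partial>M)" for n
    unfolding s_def risk_grad_def
    by (simp add: integrable_loss_grad integrable_loss_hessian)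
  have s_lim: "(\<lambda>n. s n z) \<longlonglongrightarrow> 0" if z: "z \<in> space M" for z
  proof -
    let ?t = "inner f (\<phi> z)"
    txt \<open>The difference quotient \<open>\<gamma>\<close> of \<open>l1 z\<close> at \<open>?t\<close>, continuously extended to \<open>?t\<close> by \<open>l2 z ?t\<close>.\<close>
    obtain \<gamma> where \<gamma>: "\<And>t. l1 z t - l1 z ?t = \<gamma> t * (t - ?t)" "isCont \<gamma> ?t" "\<gamma> ?t = l2 z ?t"
      using loss_deriv'[OF z, of ?t] unfolding CARAT_DERIV by blast
    have "F \<longlonglongrightarrow> f"
    proof (rule Lim_null_comparison[where g = "\<lambda>n. C * \<epsilon> n", THEN Lim_null[THEN iffD2]])
      show "\<forall>\<^sub>F n in sequentially. norm (F n - f) \<le> C * \<epsilon> n"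
        using C by simp
      show "(\<lambda>n. C * \<epsilon> n) \<longlonglongrightarrow> 0"
        using tendsto_mult_right_zero[OF \<epsilon>(2)] .
    qed
    then have "(\<lambda>n. inner (F n) (\<phi> z)) \<longlonglongrightarrow> ?t"
      by (intro tendsto_intros)
    then have "(\<lambda>n. \<gamma> (inner (F n) (\<phi> z))) \<longlonglongrightarrow> l2 z ?t"
      using isCont_tendsto_compose[OF \<gamma>(2)] \<gamma>(3) by simp
    then have lim: "(\<lambda>n. \<bar>\<gamma> (inner (F n) (\<phi> z)) - l2 z ?t\<bar> * (\<kappa> * C * \<kappa>)) \<longlonglongrightarrow> 0"
      by (intro tendsto_mult_left_zero tendsto_rabs_zero) (simp add: LIM_zero)
    \<comment> \<open>The difference \<open>\<gamma> - l2\<close> factors out of the error and tends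
      to 0, while the direction enters only through the bound \<open>C\<close>.\<close>
    have bnd: "norm (s n z) \<le> \<bar>\<gamma> (inner (F n) (\<phi> z)) - l2 z ?t\<bar> * (\<kappa> * C * \<kappa>)" for n
    proof -
      have "inner (F n) (\<phi> z) - ?t = \<epsilon> n * inner (\<phi> z) (q n)"
        by (simp add: Fq inner_add_left inner_commute[of "\<phi> z"])
      then have "loss_grad z (F n) - loss_grad z f
          = (\<gamma> (inner (F n) (\<phi> z)) * (\<epsilon> n * inner (\<phi> z) (q n))) *\<^sub>R \<phi> z"
        using \<gamma>(1)[of "inner (F n) (\<phi> z)"] by (simp add: loss_grad_def flip: scaleR_left_diff_distrib)
      then have "s n z = ((\<gamma> (inner (F n) (\<phi> z)) - l2 z ?t) * inner (\<phi> z) (q n)) *\<^sub>R \<phi> z"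
        using \<epsilon>(1)[of n] by (simp add: s_def algebra_simps)
      then have "norm (s n z) = \<bar>\<gamma> (inner (F n) (\<phi> z)) - l2 z ?t\<bar> * (\<bar>inner (q n) (\<phi> z)\<bar> * norm (\<phi> z))"
        by (simp add: abs_mult inner_commute)
      also have "\<dots> \<le> \<bar>\<gamma> (inner (F n) (\<phi> z)) - l2 z ?t\<bar> * (\<kappa> * C * \<kappa>)"
      proof (intro mult_left_mono mult_mono)
        show "\<bar>inner (q n) (\<phi> z)\<bar> \<le> \<kappa> * C"
          using abs_inner_feature_le[OF z, of "q n"] mult_left_mono[OF q feature_bound_nonneg, of n]
          by linarith
      qed (use feature_bound[OF z] feature_bound_nonneg C0 in auto)
      finally show ?thesis .
    qed
    show ?thesis
      by (rule Lim_null_comparison[OF always_eventually lim]) (use bnd in blast)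
  qed
  \<comment> \<open>The difference quotient and the derivative term are each at most
    \<open>b z * \<kappa>^2 * C\<close>, whence the factor 2.\<close>
  have s_bound: "norm (s n z) \<le> b z * (2 * \<kappa>\<^sup>2 * C)" if z: "z \<in> space M" for n z
  proof -
    have bz: "0 \<le> b z"
      by (rule b(2)[OF z])
    have "norm (loss_grad z (F n) - loss_grad z f) \<le> b z * \<kappa>\<^sup>2 * norm (F n - f)"
      using b(3)[OF z] by (intro loss_grad_lipschitz[OF z in_r]) blast
    also have "\<dots> \<le> b z * \<kappa>\<^sup>2 * (C * \<epsilon> n)"
      using bz C by (intro mult_left_mono) auto
    finally have 1: "norm ((1 / \<epsilon> n) *\<^sub>R (loss_grad z (F n) - loss_grad z f)) \<le> b z * \<kappa>\<^sup>2 * C"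
      using \<epsilon>(1)[of n] by (simp add: pos_divide_le_eq mult.assoc)
    have "\<bar>inner f (\<phi> z)\<bar> \<le> \<kappa> * r"
      using abs_inner_feature_le[OF z, of f] mult_left_mono[of "norm f" r \<kappa>] in_r(2) feature_bound_nonneg
      by auto
    then have "\<bar>l2 z (inner f (\<phi> z))\<bar> * \<bar>inner (q n) (\<phi> z)\<bar> * norm (\<phi> z) \<le> b z * (\<kappa> * C) * \<kappa>"
      using b(3)[OF z] feature_bound[OF z] feature_bound_nonneg bz C0
        order_trans[OF abs_inner_feature_le[OF z, of "q n"] mult_left_mono[OF q feature_bound_nonneg]]
      by (intro mult_mono) auto
    then have 2: "norm (?h n z) \<le> b z * \<kappa>\<^sup>2 * C"
      by (simp add: abs_mult inner_commute[of "\<phi> z"] power2_eq_square algebra_simps)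
    have "norm (s n z) \<le> norm ((1 / \<epsilon> n) *\<^sub>R (loss_grad z (F n) - loss_grad z f)) + norm (?h n z)"
      unfolding s_def by (rule norm_triangle_ineq4)
    then show ?thesis
      using 1 2 by (simp add: algebra_simps)
  qed
  have "(\<lambda>n. \<integral>z. s n z \<partial>M) \<longlonglongrightarrow> (\<integral>z. 0 \<partial>M)"
  proof (rule integral_dominated_convergence)
    show "integrable M (\<lambda>z. b z * (2 * \<kappa>\<^sup>2 * C))"
      using b(1) by simp
    show "AE z in M. (\<lambda>n. s n z) \<longlonglongrightarrow> 0"
      using s_lim by (rule AE_I2)
    show "AE z in M. norm (s n z) \<le> b z * (2 * \<kappa>\<^sup>2 * C)" for n
      using s_bound by (rule AE_I2)
  qed (use s_int in auto)
  then show ?thesis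
    by (simp add: s_eq q_def)
qed

text \<open>The two gradient equations give an exact formula for \<open>hessian f\<close> applied to
  the difference quotient, with a convergent right-hand side; the bounded inverse then carries the
  limit over to the quotient itself.\<close>

lemma risk_minimizer_diff_quotient:
  assumes w: "w \<in> space M" and zero: "reg_grad 0 w f = 0"
    and \<epsilon>: "\<And>n. 0 < \<epsilon> n" "\<And>n. \<epsilon> n \<le> 1" "\<epsilon> \<longlonglongrightarrow> 0"
    and F: "\<And>n. reg_grad (\<epsilon> n) w (F n) = 0"
  shows "(\<lambda>n. (1 / \<epsilon> n) *\<^sub>R (F n - f)) \<longlonglongrightarrow> inv (hessian f) (risk_grad f - loss_grad w f)"
proof -
  define C where "C = norm (loss_grad w f - risk_grad f) / (2 * lam)"
  have C: "norm (F n - f) \<le> C * \<epsilon> n" for n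
    unfolding C_def using \<epsilon>(1)[of n] by (intro reg_grad_zero_dist[OF w _ \<epsilon>(2) zero F]) simp
  have "0 \<le> C"
    using lam_pos by (simp add: C_def)
  define r where "r = norm f + C"
  have in_r: "F n \<in> cball 0 r" "f \<in> cball 0 r" for n
    using norm_triangle_sub[of "F n" f] C[of n] mult_left_mono[OF \<epsilon>(2) \<open>0 \<le> C\<close>, of n] \<open>0 \<le> C\<close>
    by (auto simp: r_def)
  \<comment> \<open>Applied below to \<open>risk_grad\<close> and \<open>loss_grad w\<close>: a
    Lipschitz bound on the ball gives continuity along \<open>F n\<close>.\<close>
  have lim: "(\<lambda>n. g (F n)) \<longlonglongrightarrow> g f"
    if lip: "\<exists>K. \<forall>f\<in>cball 0 r. \<forall>h\<in>cball 0 r. norm (g f - g h) \<le> K * norm (f - h)" for g :: "'h \<Rightarrow> 'h"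
  proof -
    obtain K where K: "\<And>n. norm (g (F n) - g f) \<le> K * norm (F n - f)"
      using lip in_r by blast
    have bnd: "norm (g (F n) - g f) \<le> \<bar>K\<bar> * C * \<epsilon> n" for n
      using K[of n] mult_left_mono[OF C[of n] abs_ge_zero[of K]] mult_right_mono[OF abs_ge_self[of K], of "norm (F n - f)"]
      by (simp add: mult.assoc)
    have "(\<lambda>n. \<bar>K\<bar> * C * \<epsilon> n) \<longlonglongrightarrow> 0"
      using \<epsilon>(3) by (rule tendsto_mult_right_zero)
    then have "(\<lambda>n. g (F n) - g f) \<longlonglongrightarrow> 0"
      by (rule Lim_null_comparison[rotated]) (simp add: bnd)
    then show ?thesis
      by (rule LIM_zero_cancel)
  qed
  define q where "q n = (1 / \<epsilon> n) *\<^sub>R (F n - f)" for n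
  define D where "D n = (1 / \<epsilon> n) *\<^sub>R (risk_grad (F n) - risk_grad f)
    - (\<integral>z. (l2 z (inner f (\<phi> z)) * inner (\<phi> z) (q n)) *\<^sub>R \<phi> z \<partial>M)" for n
  have "D \<longlonglongrightarrow> 0"
    unfolding D_def q_def using risk_grad_diff_quotient[OF \<epsilon>(1,3) C] .
  have "hessian f (q n) = (risk_grad (F n) - loss_grad w (F n)) - D n" for n
  proof -
    \<comment> \<open>The contamination terms are kept at \<open>F n\<close> instead of
      \<open>f\<close>, which makes the identity exact; both gradients on the right vanish.\<close>
    have "(2 * lam) *\<^sub>R (F n - f) + (risk_grad (F n) - risk_grad f)
        = reg_grad (\<epsilon> n) w (F n) - reg_grad 0 w f + \<epsilon> n *\<^sub>R (risk_grad (F n) - loss_grad w (F n))"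
      by (simp add: reg_grad_def algebra_simps)
    also have "\<dots> = \<epsilon> n *\<^sub>R (risk_grad (F n) - loss_grad w (F n))"
      by (simp add: zero F)
    finally have "(1 / \<epsilon> n) *\<^sub>R ((2 * lam) *\<^sub>R (F n - f) + (risk_grad (F n) - risk_grad f))
        = risk_grad (F n) - loss_grad w (F n)"
      using \<epsilon>(1)[of n] by simp
    then have "(2 * lam) *\<^sub>R q n + (1 / \<epsilon> n) *\<^sub>R (risk_grad (F n) - risk_grad f)
        = risk_grad (F n) - loss_grad w (F n)"
      by (simp add: q_def scaleR_add_right mult.commute)
    then show ?thesis
      by (simp add: hessian_def D_def algebra_simps)
  qed
  then have q: "q n = inv (hessian f) (risk_grad (F n) - loss_grad w (F n) - D n)" for n
    using hessian_bij[of f] by (metis bij_inv_eq_iff)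
  have "(\<lambda>n. risk_grad (F n) - loss_grad w (F n) - D n) \<longlonglongrightarrow> risk_grad f - loss_grad w f - 0"
    by (intro tendsto_diff lim risk_grad_locally_lipschitz loss_grad_locally_lipschitz w \<open>D \<longlonglongrightarrow> 0\<close>)
  then have "(\<lambda>n. inv (hessian f) (risk_grad (F n) - loss_grad w (F n) - D n))
      \<longlonglongrightarrow> inv (hessian f) (risk_grad f - loss_grad w f)"
    using bounded_linear.tendsto[OF hessian_inv_bounded_linear] by fastforce
  then show ?thesis
    unfolding q[symmetric] q_def .
qed

end

section \<open>Passage to the risk with values in [0, \<infinity>]\<close>

lemma (in smooth_convex_risk) nn_integral_reg_obj:
  assumes "0 \<le> \<epsilon>" and "\<epsilon> \<le> 1" and w: "w \<in> space M"
  shows "(\<integral>\<^sup>+ z. ennreal (l z (inner f (\<phi> z))) \<partial>mixture \<epsilon> M (return M w)) + ennreal (lam * (norm f)\<^sup>2)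
    = ennreal (reg_obj \<epsilon> w f)"
proof -
  have meas: "(\<lambda>z. l z (inner f (\<phi> z))) \<in> borel_measurable M"
    by (rule loss_measurable) measurable
  have "(\<integral>\<^sup>+ z. ennreal (l z (inner f (\<phi> z))) \<partial>M) = ennreal (\<integral>z. l z (inner f (\<phi> z)) \<partial>M)"
    using loss_nonneg by (intro nn_integral_eq_integral integrable_loss AE_I2)
  moreover have "(\<integral>\<^sup>+ z. ennreal (l z (inner f (\<phi> z))) \<partial>return M w) = ennreal (l w (inner f (\<phi> w)))"
    using w meas by (intro nn_integral_return) measurable
  moreover have "0 \<le> (\<integral>z. l z (inner f (\<phi> z)) \<partial>M)"
    using loss_nonneg by (intro integral_nonneg_AE AE_I2)
  moreover have "(\<integral>\<^sup>+ z. ennreal (l z (inner f (\<phi> z))) \<partial>mixture \<epsilon> M (return M w))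
      = ennreal (1 - \<epsilon>) * (\<integral>\<^sup>+ z. ennreal (l z (inner f (\<phi> z))) \<partial>M)
        + ennreal \<epsilon> * (\<integral>\<^sup>+ z. ennreal (l z (inner f (\<phi> z))) \<partial>return M w)"
    using meas by (intro nn_integral_mixture) auto
  ultimately show ?thesis
    using assms lam_pos loss_nonneg[OF w] by (simp add: reg_obj_def ennreal_mult ennreal_plus)
qed

section \<open>Measurability and sign of the loss derivatives\<close>

text \<open>The partial derivative is the pointwise limit of difference quotients with steps
  \<open>1 / (n + 1)\<close>, each of which is jointly measurable.\<close>

lemma borel_measurable_partial_deriv:
  fixes G G' :: "'a \<Rightarrow> real \<Rightarrow> real"
  assumes [measurable]: "case_prod G \<in> borel_measurable (N \<Otimes>\<^sub>M borel)"
    and deriv: "\<And>y t. y \<in> space N \<Longrightarrow> (G y has_real_derivative G' y t) (at t)"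
  shows "case_prod G' \<in> borel_measurable (N \<Otimes>\<^sub>M borel)"
proof (rule borel_measurable_LIMSEQ_real)
  let ?h = "\<lambda>n. inverse (real (Suc n))"
  show "(\<lambda>z. (G (fst z) (snd z + ?h n) - G (fst z) (snd z)) / ?h n) \<in> borel_measurable (N \<Otimes>\<^sub>M borel)" for n
    by measurable
  fix z :: "'a \<times> real" assume z: "z \<in> space (N \<Otimes>\<^sub>M borel)"
  have "filterlim ?h (at 0) sequentially"
    using LIMSEQ_inverse_real_of_nat by (simp add: filterlim_at)
  moreover have "((\<lambda>h. (G (fst z) (snd z + h) - G (fst z) (snd z)) / h) \<longlongrightarrow> G' (fst z) (snd z)) (at 0)"
    using z deriv by (auto simp: DERIV_def space_pair_measure)
  ultimately show "(\<lambda>n. (G (fst z) (snd z + ?h n) - G (fst z) (snd z)) / ?h n) \<longlonglongrightarrow> case_prod G' z"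
    unfolding split_beta by (rule filterlim_compose[rotated])
qed

lemma convex_imp_deriv2_nonneg:
  fixes f :: "real \<Rightarrow> real"
  assumes "convex_on UNIV f"
    and f': "\<And>t. (f has_real_derivative f' t) (at t)"
    and f'': "(f' has_real_derivative D) (at t)"
  shows "0 \<le> D"
proof -
  have above: "f' s * (u - s) \<le> f u - f s" for s u
    by (rule convex_on_imp_above_tangent[OF assms(1)]) (use f' in auto)
  have "mono f'"
  proof (rule monoI)
    fix s u :: real assume "s \<le> u"
    \<comment> \<open>The sum of the tangent inequalities at \<open>s\<close> and at
      \<open>u\<close>.\<close>
    have "f' s * (u - s) \<le> f' u * (u - s)"
      using above[of s u] above[of u s] by (simp add: algebra_simps)
    then show "f' s \<le> f' u"
      using \<open>s \<le> u\<close> by (cases "s = u") auto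
  qed
  then show ?thesis
    using mono_on_imp_deriv_nonneg[OF _ f'', of UNIV] by simp
qed

lemma abs_pow_nonneg: "0 \<le> abs_pow t p"
  by (simp add: abs_pow_def)

lemma abs_pow_mono:
  assumes "0 \<le> p" and "\<bar>s\<bar> \<le> t"
  shows "abs_pow s p \<le> abs_pow t p"
  using assms by (auto simp: abs_pow_def intro!: powr_mono2)

section \<open>The feature map of a reproducing kernel Hilbert space\<close>

text \<open>The representer of evaluation at \<open>x\<close> and \<open>\<Phi> x\<close> stand for
  the same function on \<open>X\<close>, so they coincide because \<open>fn\<close> is
  injective.\<close>

lemma rkhs_feature_map:
  assumes "is_rkhs X k fn" and "canonical_feature_map X k fn \<Phi>" and "x \<in> X"
  shows "fn f x = inner f (\<Phi> x)"
proof -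
  obtain h where h: "\<forall>u\<in>X. fn h u = k u x" "\<And>f. fn f x = inner f h"
    using assms(1,3) unfolding is_rkhs_def by blast
  have "\<forall>u\<in>X. fn (\<Phi> x) u = fn h u"
    using assms(2,3) h(1) by (simp add: canonical_feature_map_def)
  then have "\<Phi> x = h"
    using assms(1) unfolding is_rkhs_def by blast
  then show ?thesis
    by (simp add: h(2))
qed

lemma rkhs_inner_feature_map:
  assumes "is_rkhs X k fn" and "canonical_feature_map X k fn \<Phi>" and "x \<in> X" and "u \<in> X"
  shows "inner (\<Phi> x) (\<Phi> u) = k u x"
  using assms(2-4) rkhs_feature_map[OF assms(1,2,4), of "\<Phi> x"]
  by (simp add: canonical_feature_map_def)

text \<open>The squared distance of \<open>\<Phi> u\<close> and \<open>\<Phi> x\<close> is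
  \<open>k u u - 2 * k u x + k x x\<close>. Continuity is what makes \<open>\<Phi>\<close> Borel
  measurable.\<close>

lemma continuous_on_feature_map:
  assumes rkhs: "is_rkhs X k fn" "canonical_feature_map X k fn \<Phi>"
    and "continuous_kernel_on X k"
  shows "continuous_on X \<Phi>"
  unfolding continuous_on_def
proof
  fix x assume x: "x \<in> X"
  have k: "continuous_on (X \<times> X) (\<lambda>(u, v). k u v)"
    using assms(3) by (simp add: continuous_kernel_on_def)
  have "continuous_on X (\<lambda>u. case (u, u) of (u, v) \<Rightarrow> k u v)"
    by (rule continuous_on_compose2[OF k]) (auto intro!: continuous_intros)
  then have lim1: "((\<lambda>u. k u u) \<longlongrightarrow> k x x) (at x within X)"
    using x by (simp add: continuous_on_def)
  have "continuous_on X (\<lambda>u. case (u, x) of (u, v) \<Rightarrow> k u v)"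
    by (rule continuous_on_compose2[OF k]) (use x in \<open>auto intro!: continuous_intros\<close>)
  then have lim2: "((\<lambda>u. k u x) \<longlongrightarrow> k x x) (at x within X)"
    using x by (simp add: continuous_on_def)
  have "((\<lambda>u. k u u - 2 * k u x + k x x) \<longlongrightarrow> k x x - 2 * k x x + k x x) (at x within X)"
    by (intro tendsto_intros lim1 lim2)
  then have "((\<lambda>u. sqrt (k u u - 2 * k u x + k x x)) \<longlongrightarrow> 0) (at x within X)"
    using tendsto_real_sqrt by fastforce
  moreover have "dist (\<Phi> u) (\<Phi> x) = sqrt (k u u - 2 * k u x + k x x)" if "u \<in> X" for u
  proof -
    have "(norm (\<Phi> u - \<Phi> x))\<^sup>2 = inner (\<Phi> u) (\<Phi> u) - 2 * inner (\<Phi> x) (\<Phi> u) + inner (\<Phi> x) (\<Phi> x)"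
      unfolding power2_norm_eq_inner by (simp add: inner_diff_left inner_diff_right inner_commute)
    also have "\<dots> = k u u - 2 * k u x + k x x"
      using rkhs_inner_feature_map[OF rkhs] x that by simp
    finally show ?thesis
      unfolding dist_norm by (metis norm_ge_zero real_sqrt_unique)
  qed
  ultimately show "(\<Phi> \<longlongrightarrow> \<Phi> x) (at x within X)"
    unfolding tendsto_dist_iff[of \<Phi>]
    by (subst tendsto_cong[where g = "\<lambda>u. sqrt (k u u - 2 * k u x + k x x)"])
      (auto simp: eventually_at_filter)
qed

section \<open>The kernel method as an instance of the abstract setting\<close>

lemma svm_smooth_convex_risk:
  fixes fn :: "'h::{real_inner, banach, second_countable_topology} \<Rightarrow> 'x::second_countable_topology \<Rightarrow> real"
  assumes rkhs: "is_rkhs X k fn" "canonical_feature_map X k fn \<Phi>"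
    and k: "bounded_kernel_on X k" "continuous_kernel_on X k"
    and L: "loss_function Y L" "convex_loss Y L" "strong_type Y a p L"
    and a: "a \<in> borel_measurable (restrict_space borel Y)" "\<forall>y\<in>Y. 0 \<le> a y" and "0 \<le> p"
    and P: "prob_distribution_on (X \<times> Y) P" "a_moment a P < \<infinity>" and "0 < lam"
  obtains \<kappa> where "smooth_convex_risk P (\<lambda>z. \<Phi> (fst z)) (\<lambda>z. L (snd z)) (\<lambda>z. loss_deriv L (snd z))
    (\<lambda>z. loss_deriv2 L (snd z)) \<kappa> lam"
proof -
  interpret prob_space P
    using P(1) by (simp add: prob_distribution_on_def)
  have sets_P: "sets P = sets (restrict_space borel (X \<times> Y))"
    using P(1) by (simp add: prob_distribution_on_def)
  have space_P: "space P = X \<times> Y"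
    using sets_eq_imp_space_eq[OF sets_P] by (simp add: space_restrict_space)
  \<comment> \<open>The sigma-algebra of \<open>P\<close> is the Borel one restricted to
    \<open>X \<times> Y\<close>, so continuity of the projections gives measurability.\<close>
  have fst_P [measurable]: "fst \<in> measurable P (restrict_space borel X)"
    unfolding measurable_cong_sets[OF sets_P refl]
    by (intro measurable_restrict_space3 borel_measurable_continuous_onI continuous_on_fst continuous_on_id) auto
  have snd_P [measurable]: "snd \<in> measurable P (restrict_space borel Y)"
    unfolding measurable_cong_sets[OF sets_P refl]
    by (intro measurable_restrict_space3 borel_measurable_continuous_onI continuous_on_snd continuous_on_id) auto
  have [measurable]: "\<Phi> \<in> borel_measurable (restrict_space borel X)"
    by (intro borel_measurable_continuous_on_restrict continuous_on_feature_map[OF rkhs k(2)])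
  have d1: "(L y has_real_derivative loss_deriv L y t) (at t)"
    and d2: "(loss_deriv L y has_real_derivative loss_deriv2 L y t) (at t)" if "y \<in> Y" for y t
  proof -
    have eq: "loss_deriv L y = deriv (L y)"
      by (rule ext) (simp add: loss_deriv_def)
    show "(L y has_real_derivative loss_deriv L y t) (at t)"
      "(loss_deriv L y has_real_derivative loss_deriv2 L y t) (at t)"
      using L(3) that unfolding eq loss_deriv2_def strong_type_def DERIV_deriv_iff_field_differentiable
      by blast+
  qed
  have m0 [measurable]: "case_prod L \<in> borel_measurable (restrict_space borel Y \<Otimes>\<^sub>M borel)"
    using L(1) by (simp add: loss_function_def)
  have m1 [measurable]: "case_prod (loss_deriv L) \<in> borel_measurable (restrict_space borel Y \<Otimes>\<^sub>M borel)"
    by (rule borel_measurable_partial_deriv[OF m0 d1]) (simp add: space_restrict_space)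
  have m2 [measurable]: "case_prod (loss_deriv2 L) \<in> borel_measurable (restrict_space borel Y \<Otimes>\<^sub>M borel)"
    by (rule borel_measurable_partial_deriv[OF m1 d2]) (simp add: space_restrict_space)
  \<comment> \<open>\<open>B\<close> serves as \<open>\<kappa>\<close>, because
    \<open>norm (\<Phi> x)\<close> equals \<open>sqrt (k x x)\<close>.\<close>
  obtain B where B: "\<And>x. x \<in> X \<Longrightarrow> sqrt (k x x) \<le> B"
    using k(1) by (auto simp: bounded_kernel_on_def bdd_above_def)
  obtain c0 where c0: "0 < c0" "\<And>y t. y \<in> Y \<Longrightarrow> L y t \<le> c0 * (a y + abs_pow t p + 1)"
    using L(3) unfolding strong_type_def has_type_bound_def by blast
  obtain c1 where c1: "0 < c1" "\<And>y t. y \<in> Y \<Longrightarrow> \<bar>loss_deriv L y t\<bar> \<le> c1 * (a y + abs_pow t p + 1)"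
    using L(3) unfolding strong_type_def has_type_bound_def by blast
  obtain c2 where c2: "0 < c2" "\<And>y t. y \<in> Y \<Longrightarrow> \<bar>loss_deriv2 L y t\<bar> \<le> c2 * (a y + abs_pow t p + 1)"
    using L(3) unfolding strong_type_def has_type_bound_def by blast
  have L_nonneg: "0 \<le> L y t" if "y \<in> Y" for y t
    using L(1) that by (simp add: loss_function_def)
  have a_int: "integrable P (\<lambda>z. a (snd z))"
  proof (rule integrableI_nonneg)
    show "(\<lambda>z. a (snd z)) \<in> borel_measurable P"
      using measurable_comp[OF snd_P a(1)] by (simp add: comp_def)
    show "AE z in P. 0 \<le> a (snd z)"
      using a(2) space_P by (intro AE_I2) auto
  qed (use P(2) in \<open>simp add: a_moment_def\<close>)
  show ?thesis
  proof (rule that, unfold_locales)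
    show "(\<lambda>z. \<Phi> (fst z)) \<in> borel_measurable P"
      by measurable
    show "norm (\<Phi> (fst z)) \<le> B" if "z \<in> space P" for z
      using that B rkhs_inner_feature_map[OF rkhs] by (auto simp: space_P norm_eq_sqrt_inner)
    show "0 \<le> loss_deriv2 L (snd z) t" if z: "z \<in> space P" for z t
    proof -
      have y: "snd z \<in> Y"
        using z unfolding space_P by auto
      then have "convex_on UNIV (L (snd z))"
        using L(2) by (simp add: convex_loss_def)
      then show ?thesis
        by (rule convex_imp_deriv2_nonneg[OF _ d1[OF y] d2[OF y]])
    qed
    show "\<exists>b. integrable P b \<and> (\<forall>z\<in>space P. \<forall>t. \<bar>t\<bar> \<le> R \<longrightarrow> \<bar>L (snd z) t\<bar> \<le> b z \<and>
        \<bar>loss_deriv L (snd z) t\<bar> \<le> b z \<and> \<bar>loss_deriv2 L (snd z) t\<bar> \<le> b z)" for R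
    proof (intro exI conjI ballI allI impI)
      \<comment> \<open>One constant for all three bounds. The envelope is integrable because
        \<open>a\<close> has a finite moment and \<open>abs_pow R p\<close> is constant in
        \<open>z\<close>.\<close>
      let ?c = "c0 + c1 + c2"
      show "integrable P (\<lambda>z. ?c * (a (snd z) + abs_pow R p + 1))"
        using a_int by simp
      fix z t assume z: "z \<in> space P" and t: "\<bar>t\<bar> \<le> R"
      have y: "snd z \<in> Y"
        using z unfolding space_P by auto
      have bound: "c * (a (snd z) + abs_pow t p + 1) \<le> ?c * (a (snd z) + abs_pow R p + 1)"
        if "0 < c" "c \<le> ?c" for c
        using that a(2) y abs_pow_mono[OF \<open>0 \<le> p\<close> t] abs_pow_nonneg[of t p]
        by (intro mult_mono) auto
      show "\<bar>L (snd z) t\<bar> \<le> ?c * (a (snd z) + abs_pow R p + 1)"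
        using c0(2)[OF y, of t] L_nonneg[OF y, of t] bound[of c0] c0(1) c1(1) c2(1) by linarith
      show "\<bar>loss_deriv L (snd z) t\<bar> \<le> ?c * (a (snd z) + abs_pow R p + 1)"
        using c1(2)[OF y, of t] bound[of c1] c0(1) c1(1) c2(1) by linarith
      show "\<bar>loss_deriv2 L (snd z) t\<bar> \<le> ?c * (a (snd z) + abs_pow R p + 1)"
        using c2(2)[OF y, of t] bound[of c2] c0(1) c1(1) c2(1) by linarith
    qed
    show "(\<lambda>z. L (snd z) (u z)) \<in> borel_measurable P"
      "(\<lambda>z. loss_deriv L (snd z) (u z)) \<in> borel_measurable P"
      "(\<lambda>z. loss_deriv2 L (snd z) (u z)) \<in> borel_measurable P"
      if [measurable]: "u \<in> borel_measurable P" for u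
      by measurable
  qed (use space_P d1 d2 L_nonneg \<open>0 < lam\<close> in auto)
qed

section \<open>The influence function of the regularized risk minimizer\<close>

text \<open>The integrability claims guarantee that the Bochner integrals are genuine and not the
  default value 0, and bijectivity makes \<open>inv S\<close> a true inverse.\<close>

theorem theorem15:
  fixes X :: "(real ^ 'd) set" and Y :: "real set"
    and k :: "real ^ 'd \<Rightarrow> real ^ 'd \<Rightarrow> real"
    and fn :: "'h::{real_inner, banach, second_countable_topology} \<Rightarrow> real ^ 'd \<Rightarrow> real"
    and \<Phi> :: "real ^ 'd \<Rightarrow> 'h"
    and L :: "real \<Rightarrow> real \<Rightarrow> real" and a :: "real \<Rightarrow> real" and p :: real
    and P :: "((real ^ 'd) \<times> real) measure" and lam :: real
  assumes "closed X" and "X \<noteq> {}" and "closed Y" and "Y \<noteq> {}"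
    and "kernel_on X k" and "bounded_kernel_on X k" and "continuous_kernel_on X k"
    and "is_rkhs X k fn" and "canonical_feature_map X k fn \<Phi>"
    and "loss_function Y L" and "convex_loss Y L"
    and "a \<in> borel_measurable (restrict_space borel Y)" and "\<forall>y\<in>Y. 0 \<le> a y" and "0 \<le> p"
    and "strong_type Y a p L"
    and "\<forall>y\<in>Y. continuous_on UNIV (loss_deriv2 L y)"
    and "prob_distribution_on (X \<times> Y) P" and "a_moment a P < \<infinity>" and "0 < lam"
  shows "let f\<^sub>P = svm_solution L fn lam P; S = hessian_operator L fn \<Phi> lam P in
      integrable P (\<lambda>z. loss_deriv L (snd z) (fn f\<^sub>P (fst z)) *\<^sub>R \<Phi> (fst z)) \<and>
      (\<forall>g. integrable P
        (\<lambda>z. (loss_deriv2 L (snd z) (fn f\<^sub>P (fst z)) * inner (\<Phi> (fst z)) g) *\<^sub>R \<Phi> (fst z))) \<and>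
      bounded_linear S \<and> bij S \<and> bounded_linear (inv S) \<and>
      (\<forall>x\<in>X. \<forall>y\<in>Y. has_influence_function (svm_solution L fn lam) P (x, y)
        (inv S (\<integral>z. loss_deriv L (snd z) (fn f\<^sub>P (fst z)) *\<^sub>R \<Phi> (fst z) \<partial>P)
          - loss_deriv L y (fn f\<^sub>P x) *\<^sub>R inv S (\<Phi> x)))"
proof -
  obtain \<kappa> where "smooth_convex_risk P (\<lambda>z. \<Phi> (fst z)) (\<lambda>z. L (snd z)) (\<lambda>z. loss_deriv L (snd z))
      (\<lambda>z. loss_deriv2 L (snd z)) \<kappa> lam"
    using svm_smooth_convex_risk[OF assms(8,9,6,7,10,11,15,12,13,14,17,18,19)] by blast
  then interpret smooth_convex_risk P "\<lambda>z. \<Phi> (fst z)" "\<lambda>z. L (snd z)" "\<lambda>z. loss_deriv L (snd z)"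
    "\<lambda>z. loss_deriv2 L (snd z)" \<kappa> lam .
  note fn = rkhs_feature_map[OF assms(8,9)]
  have space_P: "space P = X \<times> Y"
    using assms(17) sets_eq_imp_space_eq[of P "restrict_space borel (X \<times> Y)"]
    by (simp add: prob_distribution_on_def space_restrict_space)
  define f where "f = svm_solution L fn lam P"
  have argmin: "svm_solution L fn lam Q = g"
    if "\<epsilon> \<in> {0..1}" and w: "w \<in> space P" and "reg_grad \<epsilon> w g = 0"
      and Q: "space Q = space P"
        "\<And>h. (\<integral>\<^sup>+ z. ennreal (L (snd z) (inner h (\<Phi> (fst z)))) \<partial>Q) + ennreal (lam * (norm h)\<^sup>2)
          = ennreal (reg_obj \<epsilon> w h)" for \<epsilon> w g Q
  proof -
    have "reg_risk L fn lam Q h = ennreal (reg_obj \<epsilon> w h)" for h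
    proof -
      have "(\<integral>\<^sup>+ z. ennreal (L (snd z) (fn h (fst z))) \<partial>Q)
          = (\<integral>\<^sup>+ z. ennreal (L (snd z) (inner h (\<Phi> (fst z)))) \<partial>Q)"
        using fn Q(1) space_P by (intro nn_integral_cong) auto
      then show ?thesis
        by (simp add: reg_risk_def Q(2))
    qed
    \<comment> \<open>Since \<open>reg_obj\<close> is nonnegative, \<open>ennreal\<close> preserves
      and reflects the order of its values.\<close>
    then have "is_arg_min (reg_risk L fn lam Q) (\<lambda>_. True) h \<longleftrightarrow> (\<forall>h'. reg_obj \<epsilon> w h \<le> reg_obj \<epsilon> w h')" for h
      using reg_obj_nonneg[OF w] that(1) by (simp add: is_arg_min_def not_less)
    then show ?thesis
      using reg_obj_argmin_iff[OF w _ _ that(3)] that(1) by (simp add: svm_solution_def)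
  qed
  have argmin_mix: "reg_grad \<epsilon> w (svm_solution L fn lam (mixture \<epsilon> P (return P w))) = 0"
    if \<epsilon>: "\<epsilon> \<in> {0..1}" and w: "w \<in> space P" for \<epsilon> w
  proof -
    obtain g where g: "reg_grad \<epsilon> w g = 0"
      using reg_grad_has_zero[OF w, of \<epsilon>] \<epsilon> by auto
    have "svm_solution L fn lam (mixture \<epsilon> P (return P w)) = g"
      using \<epsilon> by (intro argmin[OF \<epsilon> w g] nn_integral_reg_obj w) auto
    then show ?thesis
      using g by simp
  qed
  have zero: "reg_grad 0 w f = 0" if w: "w \<in> space P" for w
  proof -
    \<comment> \<open>The uncontaminated case is the mixture with weight 0, so it is covered by
      \<open>argmin_mix\<close>.\<close>
    have mix0: "emeasure (mixture 0 P (return P w)) A = emeasure P A" if "A \<in> sets P" for A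
      using that by (simp add: emeasure_mixture)
    have "mixture 0 P (return P w) = P"
      by (rule measure_eqI) (simp_all add: mix0)
    then show ?thesis
      using argmin_mix[of 0 w] w by (simp add: f_def)
  qed
  have fn_f: "fn f (fst z) = inner f (\<Phi> (fst z))" if "z \<in> space P" for z
    using that fn space_P by auto
  have S: "hessian_operator L fn \<Phi> lam P = hessian f"
    unfolding hessian_operator_def hessian_def f_def[symmetric]
    by (intro ext arg_cong2[where f = "(+)"] refl Bochner_Integration.integral_cong) (simp add: fn_f)
  have grad: "(\<integral>z. loss_deriv L (snd z) (fn f (fst z)) *\<^sub>R \<Phi> (fst z) \<partial>P) = risk_grad f"
    unfolding risk_grad_def loss_grad_def
    by (intro Bochner_Integration.integral_cong refl) (simp add: fn_f)
  have int1: "integrable P (\<lambda>z. loss_deriv L (snd z) (fn f (fst z)) *\<^sub>R \<Phi> (fst z))"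
    using integrable_loss_grad[of f] unfolding loss_grad_def
    by (rule Bochner_Integration.integrable_cong[THEN iffD1, rotated 2]) (simp_all add: fn_f)
  have int2: "integrable P
      (\<lambda>z. (loss_deriv2 L (snd z) (fn f (fst z)) * inner (\<Phi> (fst z)) g) *\<^sub>R \<Phi> (fst z))" for g
    using integrable_loss_hessian[of f g]
    by (rule Bochner_Integration.integrable_cong[THEN iffD1, rotated 2]) (simp_all add: fn_f)
  have "has_influence_function (svm_solution L fn lam) P (x, y)
      (inv (hessian f) (risk_grad f) - loss_deriv L y (fn f x) *\<^sub>R inv (hessian f) (\<Phi> x))"
    if "x \<in> X" "y \<in> Y" for x y
  proof -
    let ?F = "\<lambda>\<epsilon>. svm_solution L fn lam (mixture \<epsilon> P (return P (x, y)))"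
    have w: "(x, y) \<in> space P"
      using that space_P by simp
    \<comment> \<open>Restricting to the unit interval makes the sequential criterion supply only
      step sizes in (0, 1], for which the mixture is a convex combination.\<close>
    have "at (0::real) within {0..1} = at_right 0"
      by (rule at_within_Icc_at_right) simp
    moreover have "((\<lambda>\<epsilon>. (1 / \<epsilon>) *\<^sub>R (?F \<epsilon> - f)) \<longlongrightarrow> inv (hessian f) (risk_grad f - loss_grad (x, y) f))
        (at 0 within {0..1})"
      unfolding tendsto_at_iff_sequentially comp_def
    proof (intro allI impI)
      fix \<epsilon> :: "nat \<Rightarrow> real" assume \<epsilon>: "\<forall>n. \<epsilon> n \<in> {0..1} - {0}" "\<epsilon> \<longlonglongrightarrow> 0"
      have \<epsilon>01: "0 < \<epsilon> n" "\<epsilon> n \<le> 1" for n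
        using \<epsilon>(1)[rule_format, of n] by auto
      then show "(\<lambda>n. (1 / \<epsilon> n) *\<^sub>R (?F (\<epsilon> n) - f))
          \<longlonglongrightarrow> inv (hessian f) (risk_grad f - loss_grad (x, y) f)"
        using \<epsilon>(2) by (intro risk_minimizer_diff_quotient[OF w zero[OF w]] argmin_mix w)
          (auto simp: less_imp_le)
    qed
    moreover have "inv (hessian f) (risk_grad f - loss_grad (x, y) f)
        = inv (hessian f) (risk_grad f) - loss_deriv L y (fn f x) *\<^sub>R inv (hessian f) (\<Phi> x)"
    proof -
      interpret inv: bounded_linear "inv (hessian f)"
        by (rule hessian_inv_bounded_linear)
      show ?thesis
        using fn[OF that(1), of f] by (simp add: loss_grad_def inv.diff inv.scaleR)
    qed
    ultimately show ?thesis
      by (simp add: has_influence_function_def f_def)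
  qed
  then show ?thesis
    unfolding Let_def f_def[symmetric] S grad
    using int1 int2 hessian_bounded_linear hessian_bij hessian_inv_bounded_linear by blast
qed

end
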